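(* Let $\rho$ be a Borel probability measure on $\mathbb{R}$ having an exponential moment and a positive drift $\lambda=\int_{\mathbb{R}}y\,d\rho(y)>0$. Assume that $\rho$ is weakly-diophantine but that there is a real $l>0$ such that $\rho$ is not $l$-weakly-diophantine. Let $\omega\in\Omega$ be such that the map $f\mapsto (G-T_\lambda)\star f$ is (well defined and) continuous from $\mathcal{C}^\infty_c(\mathbb{R})$ to $\mathrm{L}^2_\omega(\mathbb{R})$. Then $\omega$ does not grow faster than any polynomial, i.e. there is $k\in\mathbb{N}$ such that $\liminf_{x\to+\infty}\frac{\omega(x)}{x^k}=0$.
   Context: $\rho$ has an exponential moment if $\int_{\mathbb{R}} e^{\eta|y|}\,d\rho(y)<+\infty$ for some $\eta>0$. For $|\Re(z)|<\eta$, $\widehat\rho(z)=\int_{\mathbb{R}} e^{-zy}\,d\rho(y)$. For real $l\ge 0$, $\rho$ is $l$-weakly-diophantine if $\liminf_{b\to\pm\infty}|b|^l|1-\widehat\rho(ib)|>0$ ($b$ real); it is weakly-diophantine if it is $l$-weakly-diophantine for some $l\geq 0$. $G=\sum_{n=0}^{+\infty}\tilde\rho^{\star n}$, where $\tilde\rho(A)=\int_{\mathbb{R}}\mathbf{1}_A(-y)\,d\rho(y)$, so that $G\star f(x)=\sum_{n\ge 0}\int_{\mathbb{R}} f(x+y)\,d\rho^{\star n}(y)$. $T_\lambda$ is the measure with density $\frac1\lambda\mathbf{1}_{\mathbb{R}_-}$ with respect to Lebesgue measure, so that $T_\lambda\star f(x)=\frac1\lambda\int_x^{+\infty}f(t)\,dt$.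 $\Omega$ is the set of continuous functions $\omega:\mathbb{R}\to[1,+\infty)$ such that: $\omega$ is even; for every $\varepsilon>0$, $\lim_{x\to\pm\infty}e^{-\varepsilon|x|}\omega(x)=0$; and for every $\delta>0$, $\sup\left\{\left|\int_0^{+\infty}\omega(x)e^{-zx}\,dx\right| : z\in\mathbb{C},\ \Re(z)>0,\ |z|\ge\delta\right\}$ is finite. $\mathrm{L}^2_\omega(\mathbb{R})$ is the space of $f\in\mathrm{L}^2(\mathbb{R})$ with $\int_{\mathbb{R}}\omega(x)|f(x)|^2\,dx<+\infty$, with norm the square root of this integral. $\mathcal{C}^\infty_c(\mathbb{R})$ (complex-valued functions) has its usual topology. *)

theory Defs
  imports "HOL-Probability.Probability"
begin

definition exponential_moment :: "real measure \<Rightarrow> bool" where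
  "exponential_moment \<rho> \<longleftrightarrow> (\<exists>\<eta>>0. integrable \<rho> (\<lambda>y. exp (\<eta> * \<bar>y\<bar>)))"

definition laplace_hat :: "real measure \<Rightarrow> complex \<Rightarrow> complex" where
  "laplace_hat \<rho> z = (\<integral>y. exp (- z * complex_of_real y) \<partial>\<rho>)"

text \<open>The filter \<^const>\<open>at_infinity\<close> on the reals is the filter of \<open>b \<rightarrow> \<plusminus>\<infinity>\<close>.\<close>

definition l_weakly_diophantine :: "real \<Rightarrow> real measure \<Rightarrow> bool" where
  "l_weakly_diophantine l \<rho> \<longleftrightarrow>
     Liminf at_infinity (\<lambda>b::real. ereal (\<bar>b\<bar> powr l * cmod (1 - laplace_hat \<rho> (\<i> * complex_of_real b)))) > 0"

definition weakly_diophantine :: "real measure \<Rightarrow> bool" where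
  "weakly_diophantine \<rho> \<longleftrightarrow> (\<exists>l\<ge>0. l_weakly_diophantine l \<rho>)"

primrec conv_power :: "real measure \<Rightarrow> nat \<Rightarrow> real measure" where
  "conv_power \<mu> 0 = return borel 0"
| "conv_power \<mu> (Suc n) = convolution \<mu> (conv_power \<mu> n)"

definition reflected :: "real measure \<Rightarrow> real measure" where
  "reflected \<rho> = distr \<rho> borel uminus"

definition green_measure :: "real measure \<Rightarrow> real measure" where
  "green_measure \<rho> =
     measure_of UNIV (sets borel) (\<lambda>A. \<Sum>n. emeasure (conv_power (reflected \<rho>) n) A)"

definition T_measure :: "real \<Rightarrow> real measure" where
  "T_measure lam = density lborel (\<lambda>x. ennreal (1 / lam) * indicator {..0} x)"

definition conv_fun :: "real measure \<Rightarrow> (real \<Rightarrow> complex) \<Rightarrow> real \<Rightarrow> complex" where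
  "conv_fun \<mu> f x = (\<integral>y. f (x - y) \<partial>\<mu>)"

lemma sets_conv_power [simp]: "sets (conv_power \<mu> n) = sets borel"
  by (cases n) auto

lemma sets_green_measure [simp]: "sets (green_measure \<rho>) = sets borel"
  unfolding green_measure_def by (simp add: sigma_algebra.sets_measure_of_eq sets.sigma_algebra_axioms
      flip: space_borel)

lemma emeasure_green_measure:
  assumes "A \<in> sets borel"
  shows "emeasure (green_measure \<rho>) A = (\<Sum>n. emeasure (conv_power (reflected \<rho>) n) A)"
proof (rule emeasure_measure_of[OF green_measure_def])
  show "sets borel \<subseteq> Pow (UNIV :: real set)" by simp
  show "A \<in> sets (green_measure \<rho>)" using assms by simp
  show "positive (sets (green_measure \<rho>)) (\<lambda>A. \<Sum>n. emeasure (conv_power (reflected \<rho>) n) A)"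
    by (simp add: positive_def)
  show "countably_additive (sets (green_measure \<rho>)) (\<lambda>A. \<Sum>n. emeasure (conv_power (reflected \<rho>) n) A)"
  proof (rule countably_additiveI)
    fix B :: "nat \<Rightarrow> real set"
    assume B: "range B \<subseteq> sets (green_measure \<rho>)" "disjoint_family B"
    let ?m = "\<lambda>n i. emeasure (conv_power (reflected \<rho>) n) (B i)"
    have "(\<Sum>i. \<Sum>n. ?m n i) = (\<integral>\<^sup>+n. (\<Sum>i. ?m n i) \<partial>count_space UNIV)"
      by (subst nn_integral_suminf) (auto simp: nn_integral_count_space_nat)
    also have "\<dots> = (\<Sum>n. \<Sum>i. ?m n i)"
      by (simp add: nn_integral_count_space_nat)
    also have "\<dots> = (\<Sum>n. emeasure (conv_power (reflected \<rho>) n) (\<Union>i. B i))"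
      using B by (intro suminf_cong suminf_emeasure) auto
    finally show "(\<Sum>i. \<Sum>n. ?m n i) = (\<Sum>n. emeasure (conv_power (reflected \<rho>) n) (\<Union>i. B i))" .
  qed
qed

definition Omega_class :: "(real \<Rightarrow> real) set" where
  "Omega_class = {\<omega>. continuous_on UNIV \<omega> \<and> (\<forall>x. \<omega> x \<ge> 1) \<and> (\<forall>x. \<omega> (- x) = \<omega> x) \<and>
     (\<forall>\<epsilon>>0. ((\<lambda>x. exp (- \<epsilon> * \<bar>x\<bar>) * \<omega> x) \<longlongrightarrow> 0) at_infinity) \<and>
     (\<forall>\<delta>>0. bdd_above
        ((\<lambda>z. cmod (LINT x:{0..}|lborel. complex_of_real (\<omega> x) * exp (- z * complex_of_real x)))
          ` {z. Re z > 0 \<and> cmod z \<ge> \<delta>}))}"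

text \<open>
  Elements are functions rather than classes modulo almost everywhere equality, so the norm is
  only a seminorm here. A map into this space is continuous iff the induced map into the
  quotient is.
\<close>

definition L2w :: "(real \<Rightarrow> real) \<Rightarrow> (real \<Rightarrow> complex) set" where
  "L2w \<omega> = {f. f \<in> borel_measurable lborel \<and> integrable lborel (\<lambda>x. (cmod (f x))\<^sup>2) \<and>
     integrable lborel (\<lambda>x. \<omega> x * (cmod (f x))\<^sup>2)}"

definition L2w_norm :: "(real \<Rightarrow> real) \<Rightarrow> (real \<Rightarrow> complex) \<Rightarrow> real" where
  "L2w_norm \<omega> f = sqrt (\<integral>x. \<omega> x * (cmod (f x))\<^sup>2 \<partial>lborel)"

definition L2w_topology :: "(real \<Rightarrow> real) \<Rightarrow> (real \<Rightarrow> complex) topology" where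
  "L2w_topology \<omega> = topology (\<lambda>U. U \<subseteq> L2w \<omega> \<and>
     (\<forall>f\<in>U. \<exists>\<epsilon>>0. \<forall>g\<in>L2w \<omega>. L2w_norm \<omega> (\<lambda>x. g x - f x) < \<epsilon> \<longrightarrow> g \<in> U))"

lemma openin_L2w_topology:
  "openin (L2w_topology \<omega>) U \<longleftrightarrow> U \<subseteq> L2w \<omega> \<and>
     (\<forall>f\<in>U. \<exists>\<epsilon>>0. \<forall>g\<in>L2w \<omega>. L2w_norm \<omega> (\<lambda>x. g x - f x) < \<epsilon> \<longrightarrow> g \<in> U)"
proof -
  have "istopology (\<lambda>U. U \<subseteq> L2w \<omega> \<and>
     (\<forall>f\<in>U. \<exists>\<epsilon>>0. \<forall>g\<in>L2w \<omega>. L2w_norm \<omega> (\<lambda>x. g x - f x) < \<epsilon> \<longrightarrow> g \<in> U))" (is "istopology ?P")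
    unfolding istopology_def
  proof (intro conjI allI impI)
    fix S T assume S: "?P S" and T: "?P T"
    show "S \<inter> T \<subseteq> L2w \<omega>" using S by blast
    show "\<forall>f\<in>S \<inter> T. \<exists>\<epsilon>>0. \<forall>g\<in>L2w \<omega>. L2w_norm \<omega> (\<lambda>x. g x - f x) < \<epsilon> \<longrightarrow> g \<in> S \<inter> T"
    proof
      fix f assume f: "f \<in> S \<inter> T"
      obtain e where "e > 0" "\<And>g. g \<in> L2w \<omega> \<Longrightarrow> L2w_norm \<omega> (\<lambda>x. g x - f x) < e \<Longrightarrow> g \<in> S"
        using S f by blast
      moreover obtain d where "d > 0" "\<And>g. g \<in> L2w \<omega> \<Longrightarrow> L2w_norm \<omega> (\<lambda>x. g x - f x) < d \<Longrightarrow> g \<in> T"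
        using T f by blast
      ultimately show "\<exists>\<epsilon>>0. \<forall>g\<in>L2w \<omega>. L2w_norm \<omega> (\<lambda>x. g x - f x) < \<epsilon> \<longrightarrow> g \<in> S \<inter> T"
        by (intro exI[of _ "min e d"]) auto
    qed
  next
    fix \<K> assume "\<forall>K\<in>\<K>. ?P K"
    then show "\<Union>\<K> \<subseteq> L2w \<omega>"
      and "\<forall>f\<in>\<Union>\<K>. \<exists>\<epsilon>>0. \<forall>g\<in>L2w \<omega>. L2w_norm \<omega> (\<lambda>x. g x - f x) < \<epsilon> \<longrightarrow> g \<in> \<Union>\<K>"
      by (blast, meson Union_iff)
  qed
  then show ?thesis
    unfolding L2w_topology_def by (simp add: topology_inverse')
qed

lemma topspace_L2w_topology [simp]: "topspace (L2w_topology \<omega>) = L2w \<omega>"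
proof
  show "topspace (L2w_topology \<omega>) \<subseteq> L2w \<omega>"
    by (meson openin_L2w_topology openin_topspace)
  have "openin (L2w_topology \<omega>) (L2w \<omega>)"
    unfolding openin_L2w_topology by (auto intro: exI[of _ 1])
  then show "L2w \<omega> \<subseteq> topspace (L2w_topology \<omega>)"
    by (rule openin_subset)
qed

definition iter_deriv :: "nat \<Rightarrow> (real \<Rightarrow> complex) \<Rightarrow> real \<Rightarrow> complex" where
  "iter_deriv n f = ((\<lambda>g x. vector_derivative g (at x)) ^^ n) f"

definition smooth :: "(real \<Rightarrow> complex) \<Rightarrow> bool" where
  "smooth f \<longleftrightarrow> (\<forall>n x. iter_deriv n f differentiable (at x))"

definition test_fun_on :: "real set \<Rightarrow> (real \<Rightarrow> complex) set" where
  "test_fun_on K = {f. smooth f \<and> (\<forall>x. x \<notin> K \<longrightarrow> f x = 0)}"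

definition test_fun :: "(real \<Rightarrow> complex) set" where
  "test_fun = (\<Union>K\<in>{K. compact K}. test_fun_on K)"

text \<open>For compact \<open>K\<close>: uniform convergence of all derivatives.\<close>

definition test_topology_on :: "real set \<Rightarrow> (real \<Rightarrow> complex) topology" where
  "test_topology_on K = topology (\<lambda>U. U \<subseteq> test_fun_on K \<and>
     (\<forall>f\<in>U. \<exists>N. \<exists>\<epsilon>>0. \<forall>g\<in>test_fun_on K.
        (\<forall>j\<le>N. \<forall>x. cmod (iter_deriv j (\<lambda>t. g t - f t) x) < \<epsilon>) \<longrightarrow> g \<in> U))"

text \<open>
  The locally convex inductive limit topology: basic neighbourhoods of zero are the convex
  balanced sets whose trace on each \<^term>\<open>test_fun_on K\<close> is open. Without
  \<open>0 \<in> W\<close> the empty set would qualify.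
\<close>

definition test_nhds0 :: "(real \<Rightarrow> complex) set set" where
  "test_nhds0 = {W. W \<subseteq> test_fun \<and> (\<lambda>x. 0) \<in> W \<and>
     (\<forall>f\<in>W. \<forall>g\<in>W. \<forall>t\<in>{0..1}. (\<lambda>x. complex_of_real (1 - t) * f x + complex_of_real t * g x) \<in> W) \<and>
     (\<forall>f\<in>W. \<forall>c. cmod c \<le> 1 \<longrightarrow> (\<lambda>x. c * f x) \<in> W) \<and>
     (\<forall>K. compact K \<longrightarrow> openin (test_topology_on K) (test_fun_on K \<inter> W))}"

definition test_topology :: "(real \<Rightarrow> complex) topology" where
  "test_topology = topology (\<lambda>U. U \<subseteq> test_fun \<and>
     (\<forall>f\<in>U. \<exists>W\<in>test_nhds0. \<forall>w\<in>W. (\<lambda>x. f x + w x) \<in> U))"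

lemma openin_test_topology_on:
  "openin (test_topology_on K) U \<longleftrightarrow> U \<subseteq> test_fun_on K \<and>
     (\<forall>f\<in>U. \<exists>N. \<exists>\<epsilon>>0. \<forall>g\<in>test_fun_on K.
        (\<forall>j\<le>N. \<forall>x. cmod (iter_deriv j (\<lambda>t. g t - f t) x) < \<epsilon>) \<longrightarrow> g \<in> U)"
proof -
  let ?B = "\<lambda>f N \<epsilon>. {g\<in>test_fun_on K. \<forall>j\<le>N::nat. \<forall>x. cmod (iter_deriv j (\<lambda>t. g t - f t) x) < \<epsilon>}"
  let ?P = "\<lambda>U. U \<subseteq> test_fun_on K \<and> (\<forall>f\<in>U. \<exists>N. \<exists>\<epsilon>>0. ?B f N \<epsilon> \<subseteq> U)"
  have "istopology ?P"
    unfolding istopology_def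
  proof (intro conjI allI impI)
    fix S T assume S: "?P S" and T: "?P T"
    show "S \<inter> T \<subseteq> test_fun_on K" using S by blast
    show "\<forall>f\<in>S \<inter> T. \<exists>N. \<exists>\<epsilon>>0. ?B f N \<epsilon> \<subseteq> S \<inter> T"
    proof
      fix f assume f: "f \<in> S \<inter> T"
      obtain N e where 1: "e > 0" "?B f N e \<subseteq> S" using S f by blast
      obtain M d where 2: "d > 0" "?B f M d \<subseteq> T" using T f by blast
      have "?B f (max N M) (min e d) \<subseteq> ?B f N e" "?B f (max N M) (min e d) \<subseteq> ?B f M d" by auto
      with 1 2 have "min e d > 0" "?B f (max N M) (min e d) \<subseteq> S \<inter> T" by auto
      then show "\<exists>N. \<exists>\<epsilon>>0. ?B f N \<epsilon> \<subseteq> S \<inter> T" by blast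
    qed
  next
    fix \<K> assume K: "\<forall>V\<in>\<K>. ?P V"
    then show "\<Union>\<K> \<subseteq> test_fun_on K" by blast
    show "\<forall>f\<in>\<Union>\<K>. \<exists>N. \<exists>\<epsilon>>0. ?B f N \<epsilon> \<subseteq> \<Union>\<K>"
    proof
      fix f assume "f \<in> \<Union>\<K>"
      then obtain V where V: "V \<in> \<K>" "f \<in> V" by blast
      with K obtain N e where "e > 0" "?B f N e \<subseteq> V" by blast
      with V show "\<exists>N. \<exists>\<epsilon>>0. ?B f N \<epsilon> \<subseteq> \<Union>\<K>" by (meson Union_upper order_trans)
    qed
  qed
  moreover have "test_topology_on K = topology ?P"
    unfolding test_topology_on_def by (rule arg_cong[where f = topology]) (simp add: subset_iff Ball_def imp_conjL)
  ultimately show ?thesis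
    by (simp add: topology_inverse' subset_iff Ball_def imp_conjL)
qed

lemma test_nhds0_Int:
  assumes "V \<in> test_nhds0" "W \<in> test_nhds0"
  shows "V \<inter> W \<in> test_nhds0"
proof -
  have "openin (test_topology_on K) (test_fun_on K \<inter> (V \<inter> W))" if "compact K" for K
  proof -
    have "openin (test_topology_on K) (test_fun_on K \<inter> V)"
      and "openin (test_topology_on K) (test_fun_on K \<inter> W)"
      using assms that by (simp_all add: test_nhds0_def)
    from openin_Int[OF this] show ?thesis
      by (simp only: Int_assoc Int_left_commute Int_left_absorb)
  qed
  with assms show ?thesis
    by (auto simp: test_nhds0_def)
qed

lemma openin_test_topology:
  "openin test_topology U \<longleftrightarrow> U \<subseteq> test_fun \<and>
     (\<forall>f\<in>U. \<exists>W\<in>test_nhds0. \<forall>w\<in>W. (\<lambda>x. f x + w x) \<in> U)"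
proof -
  let ?P = "\<lambda>U. U \<subseteq> test_fun \<and> (\<forall>f\<in>U. \<exists>W\<in>test_nhds0. \<forall>w\<in>W. (\<lambda>x. f x + w x) \<in> U)"
  have "istopology ?P"
    unfolding istopology_def
  proof (intro conjI allI impI)
    fix S T assume S: "?P S" and T: "?P T"
    show "S \<inter> T \<subseteq> test_fun" using S by blast
    show "\<forall>f\<in>S \<inter> T. \<exists>W\<in>test_nhds0. \<forall>w\<in>W. (\<lambda>x. f x + w x) \<in> S \<inter> T"
    proof
      fix f assume f: "f \<in> S \<inter> T"
      obtain V where "V \<in> test_nhds0" "\<forall>w\<in>V. (\<lambda>x. f x + w x) \<in> S" using S f by blast
      moreover obtain W where "W \<in> test_nhds0" "\<forall>w\<in>W. (\<lambda>x. f x + w x) \<in> T" using T f by blast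
      ultimately show "\<exists>W\<in>test_nhds0. \<forall>w\<in>W. (\<lambda>x. f x + w x) \<in> S \<inter> T"
        by (intro bexI[of _ "V \<inter> W"]) (auto intro: test_nhds0_Int)
    qed
  next
    fix \<K> assume K: "\<forall>V\<in>\<K>. ?P V"
    then show "\<Union>\<K> \<subseteq> test_fun" by blast
    show "\<forall>f\<in>\<Union>\<K>. \<exists>W\<in>test_nhds0. \<forall>w\<in>W. (\<lambda>x. f x + w x) \<in> \<Union>\<K>"
      using K by (meson Union_iff)
  qed
  then show ?thesis
    unfolding test_topology_def by (simp add: topology_inverse')
qed

end

theory Submission
  imports Defs "HOL-Computational_Algebra.Polynomial"
begin

text \<open>
  Suppose \<open>\<omega>\<close> grows faster than every polynomial. Write \<open>g(b) = 1 - \<integral>e^(-iby) d\<rho>(y)\<close> for the defect of the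
  Fourier transform and choose frequencies \<open>b\<close> tending to infinity in absolute value with
  \<open>|b|^l g(b)\<close> tending to \<open>0\<close>. Feed the wave packet \<open>f = F'\<close>, where \<open>F\<close> is a bump function
  times \<open>e^(-ibx)\<close>, into \<open>G\<close>. The response \<open>v = G \<star> f\<close> solves the renewal equation
  \<open>v(x) = f(x) + \<integral>v(x + y) d\<rho>(y)\<close> and differs from \<open>(G - T) \<star> f\<close> only by the compactly supported
  \<open>F / \<lambda>\<close>, so all its moments converge. Multiplying the renewal equation by \<open>x^j e^(ibx)\<close> and
  integrating expresses \<open>g(b) V j\<close>, with \<open>V j = \<integral>x^j e^(ibx) v(x) dx\<close>, through the lower moments.
  As \<open>g(b)\<close> tends to \<open>0\<close>, \<open>e^(-iby)\<close> tends to \<open>1\<close> in \<open>L\<^sup>2(\<rho>)\<close>, so \<open>\<integral>y e^(-iby) d\<rho>(y)\<close> tends to \<open>\<lambda> \<noteq> 0\<close>,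
  and the recursion shows that \<open>V j\<close> is of exact order \<open>g(b)^(-(j + 1))\<close>, at least \<open>|b|^(l (j + 1))\<close>.
  Continuity bounds the response to a packet by a power \<open>|b|^N\<close> that does not depend on \<open>j\<close>: a
  contradiction for large \<open>j\<close>.
\<close>

subsection \<open>Sequences of iterated derivatives\<close>


text \<open>A function is carried together with its whole tower of derivatives, so that products,
  affine substitutions and modulations have closed formulas at every order.\<close>

definition deriv_seq :: "(nat \<Rightarrow> real \<Rightarrow> complex) \<Rightarrow> bool" where
  "deriv_seq D \<longleftrightarrow> (\<forall>n x. (D n has_vector_derivative D (Suc n) x) (at x))"

lemma deriv_seqD: "deriv_seq D \<Longrightarrow> (D n has_vector_derivative D (Suc n) x) (at x)"
  by (simp add: deriv_seq_def)

text \<open>Derivatives are unique, so an explicit tower determines \<open>iter_deriv\<close>; this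
  is the bridge to the topology on test functions.\<close>

lemma iter_deriv_deriv_seq:
  assumes "deriv_seq D"
  shows "iter_deriv n (D 0) = D n"
proof (induction n)
  case 0
  then show ?case by (simp add: iter_deriv_def)
next
  case (Suc n)
  have "iter_deriv (Suc n) (D 0) = (\<lambda>x. vector_derivative (iter_deriv n (D 0)) (at x))"
    by (simp add: iter_deriv_def)
  then show ?case
    using Suc deriv_seqD[OF assms] by (auto simp: fun_eq_iff intro: vector_derivative_at)
qed

lemma smooth_deriv_seq: "deriv_seq D \<Longrightarrow> smooth (D 0)"
  unfolding smooth_def iter_deriv_deriv_seq
  by (auto simp: deriv_seq_def iter_deriv_deriv_seq intro: differentiableI_vector)

lemma deriv_seq_iter_deriv: "smooth f \<Longrightarrow> deriv_seq (\<lambda>n. iter_deriv n f)"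
  unfolding smooth_def deriv_seq_def by (simp add: iter_deriv_def vector_derivative_works)

lemma deriv_seq_lincomb:
  assumes "deriv_seq D" "deriv_seq E"
  shows "deriv_seq (\<lambda>n x. a * D n x + b * E n x)"
  using assms unfolding deriv_seq_def by (auto intro!: derivative_eq_intros)

lemma deriv_seq_Suc: "deriv_seq D \<Longrightarrow> deriv_seq (\<lambda>n. D (Suc n))"
  by (simp add: deriv_seq_def)

lemma deriv_seq_continuous: "deriv_seq D \<Longrightarrow> continuous_on A (D n)"
  using deriv_seqD
  by (blast intro: continuous_at_imp_continuous_on has_vector_derivative_continuous)

lemma smooth_lincomb:
  assumes "smooth f" "smooth g"
  shows "smooth (\<lambda>x. a * f x + b * g x)"
proof -
  have "smooth ((\<lambda>n x. a * iter_deriv n f x + b * iter_deriv n g x) 0)"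
    by (intro smooth_deriv_seq deriv_seq_lincomb deriv_seq_iter_deriv assms)
  then show ?thesis by (simp add: iter_deriv_def)
qed

text \<open>Pascal's rule after an index shift: the induction step of the Leibniz formula, kept
  apart from the analysis so that \<open>deriv_seq_mult\<close> only differentiates term by
  term.\<close>

lemma leibniz_sum:
  fixes d e :: "nat \<Rightarrow> complex"
  shows "(\<Sum>k\<le>n. of_nat (n choose k) * (d (Suc k) * e (n - k) + d k * e (Suc (n - k))))
    = (\<Sum>k\<le>Suc n. of_nat (Suc n choose k) * d k * e (Suc n - k))"
proof -
  have "(\<Sum>k\<le>n. of_nat (n choose k) * d k * e (Suc (n - k)))
      = (\<Sum>k\<le>Suc n. of_nat (n choose k) * d k * e (Suc n - k))"
    by (simp add: Suc_diff_le)
  also have "\<dots> = d 0 * e (Suc n) + (\<Sum>k\<le>n. of_nat (n choose Suc k) * d (Suc k) * e (n - k))"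
    by (subst sum.atMost_Suc_shift) simp
  finally have *: "(\<Sum>k\<le>n. of_nat (n choose k) * d k * e (Suc (n - k)))
    = d 0 * e (Suc n) + (\<Sum>k\<le>n. of_nat (n choose Suc k) * d (Suc k) * e (n - k))" .
  have "(\<Sum>k\<le>Suc n. of_nat (Suc n choose k) * d k * e (Suc n - k))
     = d 0 * e (Suc n) + (\<Sum>k\<le>n. of_nat ((n choose k) + (n choose Suc k)) * d (Suc k) * e (n - k))"
    by (subst sum.atMost_Suc_shift) simp
  with * show ?thesis
    by (simp add: algebra_simps sum.distrib)
qed

lemma deriv_seq_mult:
  assumes "deriv_seq D" "deriv_seq E"
  shows "deriv_seq (\<lambda>n x. \<Sum>k\<le>n. of_nat (n choose k) * D k x * E (n - k) x)"
  unfolding deriv_seq_def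
proof (intro allI)
  fix n x
  have "((\<lambda>x. \<Sum>k\<le>n. of_nat (n choose k) * (D k x * E (n - k) x)) has_vector_derivative
      (\<Sum>k\<le>n. of_nat (n choose k) * (D k x * E (Suc (n - k)) x + D (Suc k) x * E (n - k) x))) (at x)"
    by (intro has_vector_derivative_sum has_vector_derivative_mult_right has_vector_derivative_mult
        deriv_seqD assms)
  moreover have "(\<Sum>k\<le>n. of_nat (n choose k) * (D k x * E (Suc (n - k)) x + D (Suc k) x * E (n - k) x))
     = (\<Sum>k\<le>Suc n. of_nat (Suc n choose k) * D k x * E (Suc n - k) x)"
    by (subst leibniz_sum[symmetric]) (simp add: add.commute)
  ultimately show "((\<lambda>x. \<Sum>k\<le>n. of_nat (n choose k) * D k x * E (n - k) x) has_vector_derivative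
       (\<Sum>k\<le>Suc n. of_nat (Suc n choose k) * D k x * E (Suc n - k) x)) (at x)"
    by (simp only: mult.assoc)
qed

lemma deriv_seq_affine:
  assumes "deriv_seq D"
  shows "deriv_seq (\<lambda>n x. of_real (c ^ n) * D n (a + c * x))"
  unfolding deriv_seq_def
proof (intro allI)
  fix n x
  have "((\<lambda>x. D n (a + c * x)) has_vector_derivative c *\<^sub>R D (Suc n) (a + c * x)) (at x)"
  proof -
    have "((\<lambda>x. a + c * x) has_vector_derivative c) (at x)"
      by (auto intro!: derivative_eq_intros)
    from vector_diff_chain_at[OF this deriv_seqD[OF assms]] show ?thesis
      by (simp add: o_def)
  qed
  from has_vector_derivative_mult_right[OF this, of "of_real (c ^ n)"]
  show "((\<lambda>x. of_real (c ^ n) * D n (a + c * x)) has_vector_derivative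
      of_real (c ^ Suc n) * D (Suc n) (a + c * x)) (at x)"
    by (simp add: scaleR_conv_of_real algebra_simps)
qed

lemma deriv_seq_exp: "deriv_seq (\<lambda>n x. c ^ n * exp (c * complex_of_real x))"
  unfolding deriv_seq_def
proof (intro allI)
  fix n x
  have "((\<lambda>x. exp (c * complex_of_real x)) has_vector_derivative (c * exp (c * of_real x))) (at x)"
  proof -
    have "((\<lambda>z. exp (c * z)) has_field_derivative c * exp (c * of_real x)) (at (complex_of_real x))"
      by (auto intro!: derivative_eq_intros)
    from has_vector_derivative_real_field[OF this] show ?thesis .
  qed
  from has_vector_derivative_mult_right[OF this, of "c ^ n"]
  show "((\<lambda>x. c ^ n * exp (c * complex_of_real x)) has_vector_derivative
      c ^ Suc n * exp (c * complex_of_real x)) (at x)"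
    by (simp add: algebra_simps)
qed

subsection \<open>A bump function\<close>

text \<open>With \<open>p = 1\<close> this is the classical \<open>exp (-1/x)\<close>, extended by
  zero. Polynomial factors in \<open>1/x\<close> make the family closed under
  differentiation.\<close>

definition flat :: "real poly \<Rightarrow> real \<Rightarrow> real" where
  "flat p x = (if x > 0 then poly p (1 / x) * exp (- (1 / x)) else 0)"

lemma poly_exp_tendsto_0: "((\<lambda>t::real. poly p t * exp (- t)) \<longlongrightarrow> 0) at_top"
proof -
  have "((\<lambda>t::real. \<Sum>i\<le>degree p. coeff p i * (t ^ i / exp t)) \<longlongrightarrow> (\<Sum>i\<le>degree p. coeff p i * 0)) at_top"
    by (intro tendsto_intros tendsto_power_div_exp_0)
  then show ?thesis
    by (simp add: poly_altdef sum_distrib_right exp_minus divide_inverse mult.assoc)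
qed

text \<open>For \<open>x > 0\<close> the chain rule puts \<open>(p - p')(1/x) / x^2\<close> in front
  of the exponential; \<open>[:0, 0, 1:]\<close> supplies the \<open>1/x^2\<close>. At the origin
  the difference quotient from the right is killed by the exponential decay.\<close>

lemma flat_has_real_derivative:
  "(flat p has_real_derivative flat ([:0, 0, 1:] * (p - pderiv p)) x) (at x)"
proof -
  consider "x > 0" | "x < 0" | "x = 0" by linarith
  then show ?thesis
  proof cases
    case 1
    have "((\<lambda>x. poly p (1 / x) * exp (- (1 / x))) has_real_derivative
        flat ([:0, 0, 1:] * (p - pderiv p)) x) (at x)"
      using 1 by (auto intro!: derivative_eq_intros DERIV_chain2[OF poly_DERIV]
          simp: flat_def field_simps power2_eq_square)
    then show ?thesis
      by (rule has_field_derivative_transform_within_open[of _ _ _ "{0<..}"])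
        (use 1 in \<open>auto simp: flat_def\<close>)
  next
    case 2
    have "((\<lambda>x. 0) has_real_derivative flat ([:0, 0, 1:] * (p - pderiv p)) x) (at x)"
      using 2 by (auto simp: flat_def)
    then show ?thesis
      by (rule has_field_derivative_transform_within_open[of _ _ _ "{..<0}"])
        (use 2 in \<open>auto simp: flat_def\<close>)
  next
    case 3
    have "((\<lambda>y. flat p y / y) \<longlongrightarrow> 0) (at_left 0)"
      by (rule tendsto_eventually) (auto simp: eventually_at_left_field flat_def intro!: exI[of _ "-1"])
    moreover have "((\<lambda>y. flat p y / y) \<longlongrightarrow> 0) (at_right 0)"
    proof -
      \<comment> \<open>With \<open>t = 1/y\<close> the difference quotient becomes
        \<open>t p(t) exp (-t)\<close> at infinity, and \<open>[:0, 1:] * p\<close> is the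
        polynomial \<open>t p(t)\<close>.\<close>
      have "((\<lambda>y::real. poly ([:0, 1:] * p) (inverse y) * exp (- inverse y)) \<longlongrightarrow> 0) (at_right 0)"
        using poly_exp_tendsto_0 filterlim_inverse_at_top_right by (rule filterlim_compose)
      moreover have "\<forall>\<^sub>F y::real in at_right 0.
          poly ([:0, 1:] * p) (inverse y) * exp (- inverse y) = flat p y / y"
        by (auto simp: eventually_at_right_field flat_def field_simps intro!: exI[of _ 1])
      ultimately show ?thesis
        by (rule Lim_transform_eventually)
    qed
    ultimately have "((\<lambda>y. flat p y / y) \<longlongrightarrow> 0) (at 0)"
      by (simp add: filterlim_at_split)
    then show ?thesis
      using 3 by (simp add: has_field_derivative_iff flat_def)
  qed
qed

primrec flat_poly :: "nat \<Rightarrow> real poly" where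
  "flat_poly 0 = 1"
| "flat_poly (Suc n) = [:0, 0, 1:] * (flat_poly n - pderiv (flat_poly n))"

lemma deriv_seq_flat: "deriv_seq (\<lambda>n x. complex_of_real (flat (flat_poly n) x))"
  unfolding deriv_seq_def
  using flat_has_real_derivative
  by (auto intro!: has_vector_derivative_of_real simp flip: has_real_derivative_iff_has_vector_derivative)

text \<open>The product \<open>flat 1 (1 + x) * flat 1 (1 - x)\<close> is smooth and vanishes off
  \<open>(-1, 1)\<close>. Its integral must be nonzero because it becomes, up to scaling, the
  initial value of the moment recursion.\<close>

lemma bump_exists:
  obtains D :: "nat \<Rightarrow> real \<Rightarrow> complex"
  where "deriv_seq D" "\<And>n x. x \<notin> {-1..1} \<Longrightarrow> D n x = 0"
    "(\<integral>x. D 0 x \<partial>lborel) \<noteq> 0"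
proof -
  define H where "H = (\<lambda>n x. complex_of_real (flat (flat_poly n) x))"
  \<comment> \<open>\<open>A\<close> vanishes for \<open>x \<le> -1\<close> and \<open>B\<close> for
    \<open>x \<ge> 1\<close>; the factors \<open>1 ^ n\<close> and \<open>1 * x\<close> match the
    form of \<open>deriv_seq_affine\<close>.\<close>
  define A where "A = (\<lambda>n x. complex_of_real (1 ^ n) * H n (1 + 1 * x))"
  define B where "B = (\<lambda>n x. complex_of_real ((-1) ^ n) * H n (1 + (-1) * x))"
  define D where "D = (\<lambda>n x. \<Sum>k\<le>n. of_nat (n choose k) * A k x * B (n - k) x)"
  have H: "deriv_seq H"
    unfolding H_def by (rule deriv_seq_flat)
  have D: "deriv_seq D"
    unfolding D_def A_def B_def by (intro deriv_seq_mult deriv_seq_affine H)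
  have supp: "D n x = 0" if "x \<notin> {-1..1}" for n x
  proof -
    have "A k x = 0 \<or> B j x = 0" for k j
      using that by (auto simp: A_def B_def H_def flat_def)
    then show ?thesis
      by (auto simp: D_def intro!: sum.neutral)
  qed
  define \<phi> where "\<phi> = (\<lambda>x. flat 1 (1 + x) * flat 1 (1 - x))"
  have D0: "D 0 x = of_real (\<phi> x)" for x
    by (simp add: D_def A_def B_def H_def \<phi>_def)
  have cont: "continuous_on UNIV (flat 1)"
    using flat_has_real_derivative by (blast intro: DERIV_isCont continuous_at_imp_continuous_on)
  have cont\<phi>: "continuous_on UNIV \<phi>"
    unfolding \<phi>_def by (intro continuous_intros continuous_on_compose2[OF cont]) auto
  have zero: "\<phi> x = 0" if "x \<notin> {-1..1}" for x
    using D0[of x] supp[OF that, of 0] by simp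
  have int: "integrable lborel \<phi>"
  proof -
    have "set_integrable lborel {-1..1} \<phi>"
      unfolding set_integrable_def
      by (intro borel_integrable_compact) (auto intro: continuous_on_subset[OF cont\<phi>])
    moreover have "indicator {-1..1} x *\<^sub>R \<phi> x = \<phi> x" for x
      using zero[of x] by (auto simp: indicator_def)
    ultimately show ?thesis
      by (simp only: set_integrable_def)
  qed
  \<comment> \<open>On \<open>[-1/2, 1/2]\<close>, an interval of length one, both factors have
    arguments at least \<open>1/2\<close> and hence are at least \<open>exp (-2)\<close>
    each.\<close>
  have "exp (-4::real) = (\<integral>x. exp (-4) * indicator {-1/2..1/2::real} x \<partial>lborel)"
    by simp
  also have "\<dots> \<le> (\<integral>x. \<phi> x \<partial>lborel)"
  proof (rule integral_mono)
    fix x :: real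
    show "exp (-4) * indicator {-1/2..1/2} x \<le> \<phi> x"
    proof (cases "x \<in> {-1/2..1/2}")
      case True
      have "flat 1 y \<ge> exp (-2)" if "y \<ge> 1/2" for y
        using that by (simp add: flat_def field_simps)
      then have "exp (-2) * exp (-2) \<le> \<phi> x"
        unfolding \<phi>_def using True by (intro mult_mono) (auto simp: flat_def)
      then show ?thesis
        using True by (simp flip: exp_add)
    next
      case False
      then show ?thesis by (simp add: \<phi>_def flat_def)
    qed
  qed (use int in auto)
  finally have "(\<integral>x. \<phi> x \<partial>lborel) > 0"
    by (meson exp_gt_zero less_le_trans)
  then have "(\<integral>x. D 0 x \<partial>lborel) \<noteq> 0"
    unfolding D0 integral_complex_of_real by simp
  with D supp show thesis
    by (rule that)
qed


subsection \<open>The renewal equation for the Green measure\<close>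

lemma nn_integral_green_measure:
  assumes [measurable]: "h \<in> borel_measurable borel"
  shows "(\<integral>\<^sup>+x. h x \<partial>green_measure \<rho>) = (\<Sum>n. \<integral>\<^sup>+x. h x \<partial>conv_power (reflected \<rho>) n)"
proof -
  \<comment> \<open>The series over \<open>n\<close> is written as an integral against counting
    measure, so that monotone convergence also serves for the sum.\<close>
  have "(\<integral>\<^sup>+x. h x \<partial>green_measure \<rho>)
      = (\<integral>\<^sup>+n. (\<integral>\<^sup>+x. h x \<partial>conv_power (reflected \<rho>) n) \<partial>count_space UNIV)"
    using assms
  proof (induction rule: borel_measurable_induct)
    case (cong f g)
    then have "f = g" by auto
    with cong show ?case by simp
  next
    case (set A)
    then show ?case
      by (simp add: emeasure_green_measure nn_integral_count_space_nat)
  next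
    case (mult u c)
    then show ?case
      by (simp add: nn_integral_cmult measurable_cong_sets[OF sets_green_measure refl]
          measurable_cong_sets[OF sets_conv_power refl])
  next
    case (add u v)
    then show ?case
      by (simp add: nn_integral_add measurable_cong_sets[OF sets_green_measure refl]
          measurable_cong_sets[OF sets_conv_power refl])
  next
    case (seq U)
    have [measurable]: "U i \<in> borel_measurable borel" for i
      using seq by auto
    have "(\<integral>\<^sup>+x. (SUP i. U i x) \<partial>M) = (SUP i. \<integral>\<^sup>+x. U i x \<partial>M)" if "sets M = sets borel" for M
      using seq(3) that
      by (intro nn_integral_monotone_convergence_SUP) (auto simp: measurable_cong_sets[OF that refl])
    note * = this[OF sets_green_measure] this[OF sets_conv_power]
    have "incseq (\<lambda>i n. \<integral>\<^sup>+x. U i x \<partial>conv_power (reflected \<rho>) n)"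
      using seq(3) by (auto simp: incseq_def le_fun_def intro!: nn_integral_mono)
    from nn_integral_monotone_convergence_SUP[OF this, of "count_space UNIV"]
    show ?case
      using seq.IH by (simp add: * SUP_apply[abs_def] image_comp)
  qed
  then show ?thesis
    by (simp add: nn_integral_count_space_nat)
qed

context
  fixes \<rho> :: "real measure"
  assumes prob: "prob_space \<rho>" and sets_rho: "sets \<rho> = sets borel"
begin

lemma prob_space_reflected: "prob_space (reflected \<rho>)"
  unfolding reflected_def
  by (rule prob_space.prob_space_distr[OF prob]) (simp add: measurable_cong_sets[OF sets_rho refl])

lemma sets_reflected [simp, measurable_cong]: "sets (reflected \<rho>) = sets borel"
  by (simp add: reflected_def)

lemma finite_measure_conv_power: "finite_measure (conv_power (reflected \<rho>) n)"
proof (induction n)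
  case 0
  then show ?case
    by (simp add: prob_space.finite_measure prob_space_return)
next
  case (Suc n)
  then show ?case
    by (simp add: convolution_finite prob_space.finite_measure[OF prob_space_reflected])
qed

lemma nn_integral_conv_power_measurable:
  assumes [measurable]: "h \<in> borel_measurable borel"
  shows "(\<lambda>y. \<integral>\<^sup>+z. h (y + z) \<partial>conv_power (reflected \<rho>) n) \<in> borel_measurable borel"
proof -
  interpret finite_measure "conv_power (reflected \<rho>) n"
    by (rule finite_measure_conv_power)
  note [measurable_cong] = sets_conv_power
  show ?thesis by measurable
qed

lemma nn_integral_green_shift_measurable [measurable]:
  assumes [measurable]: "h \<in> borel_measurable borel"
  shows "(\<lambda>y. \<integral>\<^sup>+z. h (y + z) \<partial>green_measure \<rho>) \<in> borel_measurable borel"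
  using nn_integral_conv_power_measurable[OF assms]
  by (simp add: nn_integral_green_measure)

text \<open>The term \<open>n = 0\<close> of the series is the Dirac mass at zero, and each later
  power is one more convolution with \<open>reflected \<rho>\<close>. For nonnegative functions sum
  and integral may be interchanged freely.\<close>

lemma green_renewal_nn:
  assumes [measurable]: "h \<in> borel_measurable borel"
  shows "(\<integral>\<^sup>+x. h x \<partial>green_measure \<rho>)
    = h 0 + (\<integral>\<^sup>+y. \<integral>\<^sup>+z. h (y + z) \<partial>green_measure \<rho> \<partial>reflected \<rho>)"
proof -
  interpret R: prob_space "reflected \<rho>" by (rule prob_space_reflected)
  let ?a = "\<lambda>n. \<integral>\<^sup>+x. h x \<partial>conv_power (reflected \<rho>) n"
  have "(\<Sum>n. ?a n) = ?a 0 + (\<Sum>n. ?a (Suc n))"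
    using suminf_offset[of ?a 1] by simp
  also have "?a 0 = h 0"
    by (simp add: nn_integral_return)
  also have "(\<Sum>n. ?a (Suc n))
      = (\<Sum>n. \<integral>\<^sup>+y. \<integral>\<^sup>+z. h (y + z) \<partial>conv_power (reflected \<rho>) n \<partial>reflected \<rho>)"
    by (simp add: nn_integral_convolution finite_measure_conv_power R.finite_measure_axioms)
  also have "\<dots> = (\<integral>\<^sup>+y. (\<Sum>n. \<integral>\<^sup>+z. h (y + z) \<partial>conv_power (reflected \<rho>) n) \<partial>reflected \<rho>)"
    by (subst nn_integral_suminf)
      (auto simp: nn_integral_conv_power_measurable measurable_cong_sets[OF sets_reflected refl])
  finally show ?thesis
    by (simp add: nn_integral_green_measure)
qed

text \<open>In the extended identity the left side is finite, hence so is the integral on the right,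
  and \<open>h 0\<close> may be subtracted.\<close>

lemma green_renewal_nonneg:
  fixes h :: "real \<Rightarrow> real"
  assumes [measurable]: "h \<in> borel_measurable borel" and nonneg: "\<And>x. h x \<ge> 0"
    and int: "\<And>y. integrable (green_measure \<rho>) (\<lambda>z. h (y + z))"
  shows "has_bochner_integral (reflected \<rho>) (\<lambda>y. \<integral>z. h (y + z) \<partial>green_measure \<rho>)
    ((\<integral>z. h z \<partial>green_measure \<rho>) - h 0)"
proof -
  let ?H = "\<lambda>y. \<integral>z. h (y + z) \<partial>green_measure \<rho>"
  have eq: "(\<integral>\<^sup>+z. ennreal (h (y + z)) \<partial>green_measure \<rho>) = ennreal (?H y)" for y
    by (rule nn_integral_eq_integral[OF int]) (simp add: nonneg)
  have "?H = (\<lambda>y. enn2real (\<integral>\<^sup>+z. ennreal (h (y + z)) \<partial>green_measure \<rho>))"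
    unfolding eq by (simp add: nonneg)
  moreover have "(\<lambda>y. \<integral>\<^sup>+z. ennreal (h (y + z)) \<partial>green_measure \<rho>) \<in> borel_measurable borel"
    by (rule nn_integral_green_shift_measurable) simp
  ultimately have meas: "?H \<in> borel_measurable (reflected \<rho>)"
    by simp
  have ren: "ennreal (?H 0) = ennreal (h 0) + (\<integral>\<^sup>+y. ?H y \<partial>reflected \<rho>)"
    using green_renewal_nn[of "\<lambda>x. ennreal (h x)"] eq[of 0] by (simp add: eq)
  have "(\<integral>\<^sup>+y. ?H y \<partial>reflected \<rho>) = ennreal (?H 0 - h 0)" and "h 0 \<le> ?H 0"
  proof -
    have "ennreal (h 0) \<le> ennreal (?H 0)"
      unfolding ren by simp
    then show "h 0 \<le> ?H 0"
      by (simp add: nonneg)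
    have "(\<integral>\<^sup>+y. ?H y \<partial>reflected \<rho>) = ennreal (?H 0) - ennreal (h 0)"
      unfolding ren by simp
    then show "(\<integral>\<^sup>+y. ?H y \<partial>reflected \<rho>) = ennreal (?H 0 - h 0)"
      by (simp add: ennreal_minus nonneg)
  qed
  then have "has_bochner_integral (reflected \<rho>) ?H (?H 0 - h 0)"
    using meas by (intro has_bochner_integral_nn_integral) (auto simp: nonneg)
  then show ?thesis by simp
qed

lemma green_renewal_real:
  fixes h :: "real \<Rightarrow> real"
  assumes [measurable]: "h \<in> borel_measurable borel"
    and int: "\<And>y. integrable (green_measure \<rho>) (\<lambda>z. h (y + z))"
  shows "has_bochner_integral (reflected \<rho>) (\<lambda>y. \<integral>z. h (y + z) \<partial>green_measure \<rho>)
    ((\<integral>z. h z \<partial>green_measure \<rho>) - h 0)"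
proof -
  let ?p = "\<lambda>x. max 0 (h x)" and ?n = "\<lambda>x. max 0 (- h x)"
  have ip: "integrable (green_measure \<rho>) (\<lambda>z. ?p (y + z))"
    and im: "integrable (green_measure \<rho>) (\<lambda>z. ?n (y + z))" for y
    using int[of y] by auto
  have split: "(\<integral>z. h (y + z) \<partial>green_measure \<rho>)
      = (\<integral>z. ?p (y + z) \<partial>green_measure \<rho>) - (\<integral>z. ?n (y + z) \<partial>green_measure \<rho>)" for y
    by (subst Bochner_Integration.integral_diff[OF ip im, symmetric])
      (auto intro!: Bochner_Integration.integral_cong)
  have "has_bochner_integral (reflected \<rho>)
      (\<lambda>y. (\<integral>z. ?p (y + z) \<partial>green_measure \<rho>) - (\<integral>z. ?n (y + z) \<partial>green_measure \<rho>))
      (((\<integral>z. ?p z \<partial>green_measure \<rho>) - ?p 0) - ((\<integral>z. ?n z \<partial>green_measure \<rho>) - ?n 0))"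
    by (intro has_bochner_integral_diff green_renewal_nonneg ip im) auto
  then show ?thesis
    by (rule has_bochner_integral_cong[THEN iffD1, rotated 3])
      (use split[of 0] in \<open>auto simp: split max_def\<close>)
qed

lemma green_renewal:
  fixes h :: "real \<Rightarrow> complex"
  assumes [measurable]: "h \<in> borel_measurable borel"
    and int: "\<And>y. integrable (green_measure \<rho>) (\<lambda>z. h (y + z))"
  shows "has_bochner_integral (reflected \<rho>) (\<lambda>y. \<integral>z. h (y + z) \<partial>green_measure \<rho>)
    ((\<integral>z. h z \<partial>green_measure \<rho>) - h 0)"
proof -
  let ?I = "\<lambda>f y. \<integral>z. f (y + z) \<partial>green_measure \<rho>"
  have ReIm: "?I h y = complex_of_real (?I (\<lambda>z. Re (h z)) y) + \<i> * complex_of_real (?I (\<lambda>z. Im (h z)) y)" for y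
    using int[of y] by (simp add: complex_eq_iff)
  have "has_bochner_integral (reflected \<rho>)
      (\<lambda>y. complex_of_real (?I (\<lambda>z. Re (h z)) y) + \<i> * complex_of_real (?I (\<lambda>z. Im (h z)) y))
      (complex_of_real (?I (\<lambda>z. Re (h z)) 0 - Re (h 0)) + \<i> * complex_of_real (?I (\<lambda>z. Im (h z)) 0 - Im (h 0)))"
    using green_renewal_real[of "\<lambda>z. Re (h z)"] green_renewal_real[of "\<lambda>z. Im (h z)"] int
    by (intro has_bochner_integral_add has_bochner_integral_mult_right has_bochner_integral_of_real) auto
  moreover have "complex_of_real (?I (\<lambda>z. Re (h z)) 0 - Re (h 0)) + \<i> * complex_of_real (?I (\<lambda>z. Im (h z)) 0 - Im (h 0))
      = ?I h 0 - h 0"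
    unfolding ReIm by (simp add: complex_eq_iff)
  ultimately show ?thesis
    unfolding ReIm[symmetric] by simp
qed

text \<open>This is \<open>green_renewal\<close> for the function \<open>f (x - z)\<close> of
  \<open>z\<close>; undoing the reflection turns \<open>x - y\<close> into
  \<open>x + y\<close>.\<close>

lemma conv_fun_green_renewal:
  assumes f: "f \<in> borel_measurable borel"
    and int: "\<And>x. integrable (green_measure \<rho>) (\<lambda>y. f (x - y))"
  shows "integrable \<rho> (\<lambda>y. conv_fun (green_measure \<rho>) f (x + y))"
    and "conv_fun (green_measure \<rho>) f x = f x + (\<integral>y. conv_fun (green_measure \<rho>) f (x + y) \<partial>\<rho>)"
proof -
  let ?v = "conv_fun (green_measure \<rho>) f"
  have "has_bochner_integral (reflected \<rho>) (\<lambda>y. \<integral>z. f (x - (y + z)) \<partial>green_measure \<rho>)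
    ((\<integral>z. f (x - z) \<partial>green_measure \<rho>) - f (x - 0))"
    using f int by (intro green_renewal) (auto simp: diff_diff_eq[symmetric])
  then have *: "has_bochner_integral (distr \<rho> borel uminus) (\<lambda>y. ?v (x - y)) (?v x - f x)"
    by (simp add: conv_fun_def diff_diff_eq reflected_def)
  have u: "uminus \<in> measurable \<rho> borel"
    by (simp add: measurable_cong_sets[OF sets_rho refl])
  from * have m: "(\<lambda>y. ?v (x - y)) \<in> borel_measurable borel"
    by (auto simp: has_bochner_integral_iff dest: borel_measurable_integrable)
  show "integrable \<rho> (\<lambda>y. ?v (x + y))"
    using * integrable_distr_eq[OF u m] by (simp add: has_bochner_integral_iff)
  show "?v x = f x + (\<integral>y. ?v (x + y) \<partial>\<rho>)"
    using * integral_distr[OF u m] by (simp add: has_bochner_integral_iff)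
qed

end


subsection \<open>Moments of solutions of the renewal equation\<close>

text \<open>The renewal equation is multiplied by \<open>x^j e^(ibx)\<close> and integrated with
  Fubini. The translation \<open>x = s - y\<close> turns \<open>v (x + y)\<close> into
  \<open>v s\<close>, and the binomial theorem splits \<open>(s - y)^j\<close>, whence the
  \<open>- y\<close> in \<open>m\<close>.\<close>

lemma moment_renewal:
  fixes \<rho> :: "real measure" and v f :: "real \<Rightarrow> complex" and b :: real
  defines "m \<equiv> \<lambda>i. \<integral>y. complex_of_real (- y) ^ i * exp (- \<i> * of_real (b * y)) \<partial>\<rho>"
    and "V \<equiv> \<lambda>i. \<integral>x. complex_of_real x ^ i * exp (\<i> * of_real (b * x)) * v x \<partial>lborel"
  assumes prob: "prob_space \<rho>" and sets_rho [measurable_cong]: "sets \<rho> = sets borel"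
    and v [measurable]: "v \<in> borel_measurable borel"
    and intv: "\<And>i. i \<le> j \<Longrightarrow> integrable lborel (\<lambda>x. complex_of_real x ^ i * v x)"
    and int\<rho>: "\<And>i. i \<le> j \<Longrightarrow> integrable \<rho> (\<lambda>y. \<bar>y\<bar> ^ i)"
    and renewal: "\<And>x. v x = f x + (\<integral>y. v (x + y) \<partial>\<rho>)"
  shows "V j = (\<integral>x. complex_of_real x ^ j * exp (\<i> * of_real (b * x)) * f x \<partial>lborel)
    + (\<Sum>i\<le>j. of_nat (j choose i) * m i * V (j - i))"
proof -
  interpret R: prob_space \<rho> by (rule prob)
  interpret pair_sigma_finite \<rho> lborel ..
  let ?e = "\<lambda>x. exp (\<i> * complex_of_real (b * x))"
  define \<Psi> where "\<Psi> = (\<lambda>(y, x). complex_of_real x ^ j * ?e x * v (x + y))"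
  define K where "K = (\<lambda>i y. of_nat (j choose i) * (complex_of_real (- y) ^ i * exp (- \<i> * of_real (b * y))))"
  define P where "P = (\<lambda>i s. complex_of_real s ^ i * ?e s * v s)"
  have [measurable]: "\<Psi> \<in> borel_measurable (\<rho> \<Otimes>\<^sub>M lborel)"
    unfolding \<Psi>_def by measurable
  have [measurable]: "P i \<in> borel_measurable borel" "K i \<in> borel_measurable borel" for i
    unfolding P_def K_def by measurable
  have Pint: "integrable lborel (P i)" if "i \<le> j" for i
    by (rule Bochner_Integration.integrable_bound[OF intv[OF that]]) (auto simp: P_def norm_mult)
  have Kint: "integrable \<rho> (\<lambda>y. complex_of_real (- y) ^ i * exp (- \<i> * of_real (b * y)))" if "i \<le> j" for i
    by (rule Bochner_Integration.integrable_bound[OF int\<rho>[OF that]]) (auto simp: norm_mult norm_power)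
  \<comment> \<open>The form \<open>- y + 1 * s\<close> is that of the affine substitution rule for
    \<open>lborel\<close>. After the shift, the variables are separated up to a finite sum.\<close>
  have \<Psi>_shift: "\<Psi> (y, - y + 1 * s) = (\<Sum>i\<le>j. K i y * P (j - i) s)" for y s
  proof -
    have "?e (s - y) = exp (- \<i> * of_real (b * y)) * ?e s"
      by (simp add: algebra_simps flip: exp_add)
    moreover have "complex_of_real (s - y) ^ j
        = (\<Sum>i\<le>j. of_nat (j choose i) * complex_of_real (- y) ^ i * complex_of_real s ^ (j - i))"
      using binomial_ring[of "complex_of_real (- y)" "complex_of_real s" j] by simp
    ultimately have "\<Psi> (y, s - y) = (\<Sum>i\<le>j. of_nat (j choose i) * complex_of_real (- y) ^ i * complex_of_real s ^ (j - i))
        * (exp (- \<i> * of_real (b * y)) * ?e s) * v s"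
      by (simp add: \<Psi>_def)
    also have "\<dots> = (\<Sum>i\<le>j. K i y * P (j - i) s)"
      unfolding sum_distrib_right by (intro sum.cong) (auto simp: K_def P_def)
    finally show ?thesis by (simp add: algebra_simps)
  qed
  have shift_int: "integrable lborel (\<lambda>s. \<Sum>i\<le>j. K i y * P (j - i) s)" for y
    by (intro Bochner_Integration.integrable_sum Bochner_Integration.integrable_mult_right Pint) auto
  have \<Psi>_int: "integrable lborel (\<lambda>x. \<Psi> (y, x))" for y
    using lborel_integrable_real_affine_iff[of 1 "\<lambda>x. \<Psi> (y, x)" "- y"] shift_int[of y]
    unfolding \<Psi>_shift by simp
  have \<Psi>_eq: "(\<integral>x. \<Psi> (y, x) \<partial>lborel) = (\<Sum>i\<le>j. K i y * V (j - i))" for y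
  proof -
    have "(\<integral>x. \<Psi> (y, x) \<partial>lborel) = (\<integral>s. (\<Sum>i\<le>j. K i y * P (j - i) s) \<partial>lborel)"
      using lborel_integral_real_affine[of 1 "\<lambda>x. \<Psi> (y, x)" "- y"] unfolding \<Psi>_shift by simp
    also have "\<dots> = (\<Sum>i\<le>j. \<integral>s. K i y * P (j - i) s \<partial>lborel)"
      by (intro Bochner_Integration.integral_sum Bochner_Integration.integrable_mult_right Pint) auto
    finally show ?thesis
      by (simp add: V_def P_def)
  qed
  \<comment> \<open>This provides the dominating function for Fubini: it depends on \<open>y\<close>
    only through the powers \<open>|y|^i\<close>, whose \<open>\<rho>\<close>-integrals are
    finite.\<close>
  have \<Psi>_norm: "(\<integral>x. norm (\<Psi> (y, x)) \<partial>lborel)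
      \<le> (\<Sum>i\<le>j. real (j choose i) * \<bar>y\<bar> ^ i * (\<integral>s. norm (P (j - i) s) \<partial>lborel))" for y
  proof -
    have "(\<integral>x. norm (\<Psi> (y, x)) \<partial>lborel) = (\<integral>s. norm (\<Sum>i\<le>j. K i y * P (j - i) s) \<partial>lborel)"
      using lborel_integral_real_affine[of 1 "\<lambda>x. norm (\<Psi> (y, x))" "- y"] unfolding \<Psi>_shift by simp
    also have "\<dots> \<le> (\<integral>s. (\<Sum>i\<le>j. norm (K i y) * norm (P (j - i) s)) \<partial>lborel)"
    proof (rule integral_mono)
      show "norm (\<Sum>i\<le>j. K i y * P (j - i) s) \<le> (\<Sum>i\<le>j. norm (K i y) * norm (P (j - i) s))" for s
        by (rule order_trans[OF norm_sum]) (simp add: norm_mult)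
      show "integrable lborel (\<lambda>s. norm (\<Sum>i\<le>j. K i y * P (j - i) s))"
        using shift_int by (rule integrable_norm)
      show "integrable lborel (\<lambda>s. \<Sum>i\<le>j. norm (K i y) * norm (P (j - i) s))"
        by (intro Bochner_Integration.integrable_sum Bochner_Integration.integrable_mult_right
            integrable_norm Pint) auto
    qed
    also have "\<dots> = (\<Sum>i\<le>j. \<integral>s. norm (K i y) * norm (P (j - i) s) \<partial>lborel)"
      by (intro Bochner_Integration.integral_sum Bochner_Integration.integrable_mult_right
          integrable_norm Pint) auto
    also have "\<dots> = (\<Sum>i\<le>j. real (j choose i) * \<bar>y\<bar> ^ i * (\<integral>s. norm (P (j - i) s) \<partial>lborel))"
      by (simp add: K_def norm_mult norm_power)
    finally show ?thesis .
  qed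
  have bound_int: "integrable \<rho> (\<lambda>y. \<Sum>i\<le>j. real (j choose i) * \<bar>y\<bar> ^ i * (\<integral>s. norm (P (j - i) s) \<partial>lborel))"
    by (intro Bochner_Integration.integrable_sum Bochner_Integration.integrable_mult_left
        Bochner_Integration.integrable_mult_right int\<rho>) auto
  have pair: "integrable (\<rho> \<Otimes>\<^sub>M lborel) \<Psi>"
  proof (rule Fubini_integrable)
    show "integrable \<rho> (\<lambda>y. \<integral>x. norm (\<Psi> (y, x)) \<partial>lborel)"
    proof (rule Bochner_Integration.integrable_bound[OF bound_int])
      show "(\<lambda>y. \<integral>x. norm (\<Psi> (y, x)) \<partial>lborel) \<in> borel_measurable \<rho>"
        by (rule lborel.borel_measurable_lebesgue_integral) simp
      have "norm (\<integral>x. norm (\<Psi> (y, x)) \<partial>lborel)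
          \<le> norm (\<Sum>i\<le>j. real (j choose i) * \<bar>y\<bar> ^ i * (\<integral>s. norm (P (j - i) s) \<partial>lborel))" for y
        using \<Psi>_norm[of y] by (simp add: abs_of_nonneg)
      then show "AE y in \<rho>. norm (\<integral>x. norm (\<Psi> (y, x)) \<partial>lborel)
          \<le> norm (\<Sum>i\<le>j. real (j choose i) * \<bar>y\<bar> ^ i * (\<integral>s. norm (P (j - i) s) \<partial>lborel))"
        by simp
    qed
  qed (use \<Psi>_int in auto)
  have "(\<integral>x. (\<integral>y. \<Psi> (y, x) \<partial>\<rho>) \<partial>lborel) = (\<integral>y. (\<integral>x. \<Psi> (y, x) \<partial>lborel) \<partial>\<rho>)"
    using Fubini_integral[of "\<lambda>y x. \<Psi> (y, x)"] pair by simp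
  also have "\<dots> = (\<integral>y. (\<Sum>i\<le>j. K i y * V (j - i)) \<partial>\<rho>)"
    by (simp add: \<Psi>_eq)
  also have "\<dots> = (\<Sum>i\<le>j. \<integral>y. K i y * V (j - i) \<partial>\<rho>)"
    unfolding K_def
    by (intro Bochner_Integration.integral_sum Bochner_Integration.integrable_mult_left
        Bochner_Integration.integrable_mult_right Kint) auto
  also have "\<dots> = (\<Sum>i\<le>j. of_nat (j choose i) * m i * V (j - i))"
    by (simp add: K_def m_def)
  finally have sum: "(\<integral>x. (\<integral>y. \<Psi> (y, x) \<partial>\<rho>) \<partial>lborel) = (\<Sum>i\<le>j. of_nat (j choose i) * m i * V (j - i))" .
  have snd: "integrable lborel (\<lambda>x. \<integral>y. \<Psi> (y, x) \<partial>\<rho>)"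
    using integrable_snd[of "\<lambda>y x. \<Psi> (y, x)"] pair by simp
  \<comment> \<open>Integrated in the other order, the inner integral is evaluated by the renewal
    equation itself.\<close>
  have "(\<integral>y. \<Psi> (y, x) \<partial>\<rho>) = P j x - complex_of_real x ^ j * ?e x * f x" for x
    using renewal[of x] by (simp add: \<Psi>_def P_def algebra_simps)
  then have f_eq: "complex_of_real x ^ j * ?e x * f x = P j x - (\<integral>y. \<Psi> (y, x) \<partial>\<rho>)" for x
    by simp
  have "(\<integral>x. complex_of_real x ^ j * ?e x * f x \<partial>lborel) = V j - (\<integral>x. (\<integral>y. \<Psi> (y, x) \<partial>\<rho>) \<partial>lborel)"
    unfolding f_eq by (subst Bochner_Integration.integral_diff[OF Pint snd]) (simp_all add: V_def P_def)
  with sum show ?thesis by simp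
qed

text \<open>In the limit only the term \<open>i = 1\<close> of the sum survives, so the limits
  satisfy \<open>L j = j * \<mu> * L (j - 1)\<close> with \<open>L 0 = c\<close>, and none of them
  vanishes.\<close>

lemma recursion_limit_nonzero:
  fixes U e a :: "nat \<Rightarrow> nat \<Rightarrow> complex" and \<mu> c :: complex
  assumes rec: "\<And>j n. U j n = e j n + (\<Sum>i=1..j. of_nat (j choose i) * a i n * U (j - i) n)"
    and e0: "e 0 \<longlonglongrightarrow> c" and c: "c \<noteq> 0"
    and e: "\<And>j. j \<ge> 1 \<Longrightarrow> e j \<longlonglongrightarrow> 0"
    and a1: "a 1 \<longlonglongrightarrow> \<mu>" and \<mu>: "\<mu> \<noteq> 0"
    and a: "\<And>i. i \<ge> 2 \<Longrightarrow> a i \<longlonglongrightarrow> 0"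
  shows "\<exists>L. L \<noteq> 0 \<and> U j \<longlonglongrightarrow> L"
proof (induction j rule: less_induct)
  case (less j)
  show ?case
  proof (cases j)
    case 0
    have "U 0 = e 0" using rec[of 0] by auto
    then show ?thesis using 0 e0 c by auto
  next
    case (Suc k)
    have "\<exists>L. \<forall>i<j. L i \<noteq> 0 \<and> U i \<longlonglongrightarrow> L i"
      using less by metis
    then obtain L where L: "\<And>i. i < j \<Longrightarrow> L i \<noteq> 0 \<and> U i \<longlonglongrightarrow> L i"
      by blast
    define A where "A = (\<lambda>i::nat. if i = 1 then \<mu> else 0)"
    have A: "a i \<longlonglongrightarrow> A i" if "i \<ge> 1" for i
      using that a1 a[of i] by (cases "i = 1") (auto simp: A_def)
    have "(\<lambda>n. e j n + (\<Sum>i=1..j. of_nat (j choose i) * a i n * U (j - i) n))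
        \<longlonglongrightarrow> 0 + (\<Sum>i=1..j. of_nat (j choose i) * A i * L (j - i))"
      using Suc L by (intro tendsto_intros e A) auto
    moreover have "(\<Sum>i=1..j. of_nat (j choose i) * A i * L (j - i)) = of_nat j * \<mu> * L k"
      using Suc by (subst sum.remove[of _ 1]) (auto simp: A_def)
    ultimately have "U j \<longlonglongrightarrow> of_nat j * \<mu> * L k"
      by (simp add: rec[of j, abs_def])
    moreover have "of_nat j * \<mu> * L k \<noteq> 0"
      using Suc L[of k] \<mu> by (simp del: of_nat_Suc)
    ultimately show ?thesis by blast
  qed
qed


section \<open>Convolution of a derivative with the comparison measure\<close>

text \<open>The integral over the half-line to the right of \<open>x\<close> gives back the
  primitive by the fundamental theorem of calculus. For packets that are derivatives the comparison
  term thus has compact support.\<close>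

lemma conv_fun_T_measure:
  assumes D: "deriv_seq D" and supp: "\<And>n x. x \<notin> {-1..1} \<Longrightarrow> D n x = 0" and lam: "lam > 0"
  shows "conv_fun (T_measure lam) (D (Suc 0)) x = - D 0 x / of_real lam"
proof -
  let ?f = "D (Suc 0)"
  have cont: "continuous_on A (D n)" for A n
    by (rule deriv_seq_continuous[OF D])
  have [measurable]: "D n \<in> borel_measurable borel" for n
    using cont by (rule borel_measurable_continuous_onI)
  have "(\<lambda>y. ennreal (1 / lam) * indicator {..0} y) = (\<lambda>y. ennreal (1 / lam * indicator {..0::real} y))"
    by (auto simp: fun_eq_iff indicator_def)
  then have "conv_fun (T_measure lam) ?f x = (\<integral>y. ?f (x - y) \<partial>density lborel (\<lambda>y. ennreal (1 / lam * indicator {..0} y)))"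
    by (simp only: conv_fun_def T_measure_def)
  also have "\<dots> = (\<integral>y. (1 / lam * indicator {..0} y) *\<^sub>R ?f (x - y) \<partial>lborel)"
    using lam by (intro integral_density) auto
  also have "\<dots> = (\<integral>t. (1 / lam * indicator {..0} (x - t)) *\<^sub>R ?f t \<partial>lborel)"
    using lborel_integral_real_affine[of "-1" "\<lambda>t. (1 / lam * indicator {..0} (x - t)) *\<^sub>R ?f t" x]
    by simp
  \<comment> \<open>The upper end \<open>max x 2\<close> lies past the support and never to the left
    of \<open>x\<close>, so the fundamental theorem applies on a compact interval for every
    \<open>x\<close>.\<close>
  also have "\<dots> = (\<integral>t. (1 / lam) *\<^sub>R (indicator {x..max x 2} t *\<^sub>R ?f t) \<partial>lborel)"
  proof (rule Bochner_Integration.integral_cong[OF refl])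
    fix t
    have "?f t = 0" if "\<not> t \<le> max x 2"
      using that by (intro supp) auto
    then show "(1 / lam * indicator {..0} (x - t)) *\<^sub>R ?f t = (1 / lam) *\<^sub>R (indicator {x..max x 2} t *\<^sub>R ?f t)"
      by (auto simp: indicator_def)
  qed
  also have "\<dots> = (1 / lam) *\<^sub>R (\<integral>t. indicator {x..max x 2} t *\<^sub>R ?f t \<partial>lborel)"
    by (rule integral_scaleR_right)
  also have "(\<integral>t. indicator {x..max x 2} t *\<^sub>R ?f t \<partial>lborel) = D 0 (max x 2) - D 0 x"
    by (rule integral_FTC_Icc)
      (auto intro!: cont has_vector_derivative_at_within deriv_seqD[OF D])
  also have "D 0 (max x 2) = 0"
    by (rule supp) auto
  finally show ?thesis
    by (simp add: scaleR_conv_of_real divide_inverse mult.commute)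
qed

subsection \<open>Continuity from test functions to the weighted space\<close>

lemma test_fun_lincomb:
  assumes "f \<in> test_fun" "g \<in> test_fun"
  shows "(\<lambda>x. a * f x + b * g x) \<in> test_fun"
proof -
  obtain K L where K: "compact K" "f \<in> test_fun_on K" and L: "compact L" "g \<in> test_fun_on L"
    using assms by (auto simp: test_fun_def)
  have "(\<lambda>x. a * f x + b * g x) \<in> test_fun_on (K \<union> L)"
    using K L by (auto simp: test_fun_on_def intro: smooth_lincomb)
  with K L show ?thesis
    unfolding test_fun_def by blast
qed

lemma zero_deriv_seq: "deriv_seq (\<lambda>n x. 0)"
  by (simp add: deriv_seq_def)

lemma zero_test_fun_on: "(\<lambda>x. 0) \<in> test_fun_on K"
  using smooth_deriv_seq[OF zero_deriv_seq] by (simp add: test_fun_on_def)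

lemma zero_test_fun: "(\<lambda>x. 0) \<in> test_fun"
  using zero_test_fun_on[of "{}"] by (auto simp: test_fun_def)

lemma test_fun_test_nhds0: "test_fun \<in> test_nhds0"
proof -
  have "openin (test_topology_on K) (test_fun_on K \<inter> test_fun)" if "compact K" for K
  proof -
    have "test_fun_on K \<inter> test_fun = test_fun_on K"
      using that by (auto simp: test_fun_def)
    then show ?thesis
      unfolding openin_test_topology_on by (auto intro: exI[of _ 1])
  qed
  moreover have "(\<lambda>x. c * f x) \<in> test_fun" if "f \<in> test_fun" for f c
    using test_fun_lincomb[OF that zero_test_fun, of c 0] by simp
  ultimately show ?thesis
    by (auto simp: test_nhds0_def zero_test_fun intro: test_fun_lincomb)
qed

lemma openin_test_fun: "openin test_topology test_fun"
  unfolding openin_test_topology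
  using test_fun_test_nhds0 test_fun_lincomb[of _ _ 1 1] by auto

lemma openin_L2w_ball:
  assumes [measurable]: "\<omega> \<in> borel_measurable borel" and nonneg: "\<And>x. \<omega> x \<ge> 0"
  shows "openin (L2w_topology \<omega>) {f \<in> L2w \<omega>. (\<integral>x. \<omega> x * (cmod (f x))\<^sup>2 \<partial>lborel) < 1}"
  unfolding openin_L2w_topology
proof (intro conjI ballI)
  let ?I = "\<lambda>f. \<integral>x. \<omega> x * (cmod (f x))\<^sup>2 \<partial>lborel"
  fix f assume "f \<in> {f \<in> L2w \<omega>. ?I f < 1}"
  then have f: "f \<in> L2w \<omega>" "?I f < 1" by auto
  define t where "t = (1 - ?I f) / 2"
  have t: "t > 0" using f by (simp add: t_def)
  have If: "?I f \<ge> 0"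
    using nonneg by (intro Bochner_Integration.integral_nonneg) simp
  \<comment> \<open>Chosen so that \<open>(1 + 1/t) * e^2 = t/2\<close>. As
    \<open>?I f = 1 - 2 * t\<close>, the final estimate is at most
    \<open>(1 - t) + t/2 < 1\<close>.\<close>
  define e where "e = sqrt (t\<^sup>2 / (2 * (t + 1)))"
  have e: "e > 0" using t by (simp add: e_def)
  show "\<exists>\<epsilon>>0. \<forall>g\<in>L2w \<omega>. L2w_norm \<omega> (\<lambda>x. g x - f x) < \<epsilon> \<longrightarrow> g \<in> {f \<in> L2w \<omega>. ?I f < 1}"
  proof (intro exI[of _ e] conjI e ballI impI)
    fix g assume g: "g \<in> L2w \<omega>" and d: "L2w_norm \<omega> (\<lambda>x. g x - f x) < e"
    let ?h = "\<lambda>x. g x - f x"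
    have [measurable]: "f \<in> borel_measurable borel" "g \<in> borel_measurable borel"
      using f g by (auto simp: L2w_def)
    have intf: "integrable lborel (\<lambda>x. \<omega> x * (cmod (f x))\<^sup>2)"
      and intg: "integrable lborel (\<lambda>x. \<omega> x * (cmod (g x))\<^sup>2)"
      using f g by (auto simp: L2w_def)
    \<comment> \<open>A weighted Young inequality takes the place of the triangle inequality for the
      norm; small \<open>s\<close> keeps the coefficient of \<open>(cmod w)^2\<close> close to
      one.\<close>
    have young: "(cmod u)\<^sup>2 \<le> (1 + s) * (cmod w)\<^sup>2 + (1 + 1 / s) * (cmod (u - w))\<^sup>2" if "s > 0" for u w s
    proof -
      have "0 \<le> (sqrt s * cmod w - cmod (u - w) / sqrt s)\<^sup>2" by simp
      also have "\<dots> = s * (cmod w)\<^sup>2 + (cmod (u - w))\<^sup>2 / s - 2 * cmod w * cmod (u - w)"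
        using that by (simp add: power2_diff power_mult_distrib power_divide)
      finally have "2 * cmod w * cmod (u - w) \<le> s * (cmod w)\<^sup>2 + (cmod (u - w))\<^sup>2 / s" by simp
      moreover have "(cmod u)\<^sup>2 \<le> (cmod w + cmod (u - w))\<^sup>2"
        using norm_triangle_ineq[of w "u - w"] by (intro power_mono) auto
      ultimately show ?thesis
        by (simp add: power2_sum algebra_simps)
    qed
    have inth: "integrable lborel (\<lambda>x. \<omega> x * (cmod (?h x))\<^sup>2)"
    proof (rule Bochner_Integration.integrable_bound)
      show "integrable lborel (\<lambda>x. 2 * (\<omega> x * (cmod (g x))\<^sup>2) + 2 * (\<omega> x * (cmod (f x))\<^sup>2))"
        using intf intg by simp
      have "\<omega> x * (cmod (?h x))\<^sup>2 \<le> 2 * (\<omega> x * (cmod (g x))\<^sup>2) + 2 * (\<omega> x * (cmod (f x))\<^sup>2)" for x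
        using mult_left_mono[OF young[of 1 "?h x" "- f x"] nonneg[of x]] by (simp add: algebra_simps)
      then show "AE x in lborel. norm (\<omega> x * (cmod (?h x))\<^sup>2)
          \<le> norm (2 * (\<omega> x * (cmod (g x))\<^sup>2) + 2 * (\<omega> x * (cmod (f x))\<^sup>2))"
        using nonneg by simp
    qed simp
    have Ih: "?I ?h \<ge> 0"
      using nonneg by (intro Bochner_Integration.integral_nonneg) simp
    have "?I ?h < t\<^sup>2 / (2 * (t + 1))"
      using d by (simp add: L2w_norm_def e_def)
    then have "(1 + 1 / t) * ?I ?h \<le> (1 + 1 / t) * (t\<^sup>2 / (2 * (t + 1)))"
      using t by (intro mult_left_mono) auto
    also have "\<dots> = t / 2"
      using t by (simp add: divide_simps power2_eq_square)
    finally have B: "(1 + 1 / t) * ?I ?h \<le> t / 2" .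
    have "?I g \<le> (\<integral>x. (1 + t) * (\<omega> x * (cmod (f x))\<^sup>2) + (1 + 1 / t) * (\<omega> x * (cmod (?h x))\<^sup>2) \<partial>lborel)"
    proof (rule integral_mono[OF intg])
      show "integrable lborel (\<lambda>x. (1 + t) * (\<omega> x * (cmod (f x))\<^sup>2) + (1 + 1 / t) * (\<omega> x * (cmod (?h x))\<^sup>2))"
        using intf inth by simp
      show "\<omega> x * (cmod (g x))\<^sup>2 \<le> (1 + t) * (\<omega> x * (cmod (f x))\<^sup>2) + (1 + 1 / t) * (\<omega> x * (cmod (?h x))\<^sup>2)" for x
        using mult_left_mono[OF young[OF t, of "g x" "f x"] nonneg[of x]] by (simp add: algebra_simps)
    qed
    also have "\<dots> = (1 + t) * ?I f + (1 + 1 / t) * ?I ?h"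
      using intf inth by simp
    also have "\<dots> < 1"
    proof -
      have "t * ?I f \<le> t * 1"
        using f t by (intro mult_left_mono) auto
      then have "(1 + t) * ?I f \<le> ?I f + t" by (simp add: algebra_simps)
      also have "\<dots> = 1 - t" by (simp add: t_def field_simps)
      finally show ?thesis using B t by linarith
    qed
    finally show "g \<in> {f \<in> L2w \<omega>. ?I f < 1}"
      using g by simp
  qed
qed auto

text \<open>The preimage of the unit ball contains a basic neighbourhood of zero, whose trace on
  \<open>test_fun_on K\<close> is governed by finitely many derivatives. The order \<open>N\<close>
  depends on \<open>K\<close>, but not on the frequency of a packet supported there.\<close>

lemma continuous_map_L2w_bound:
  assumes cont: "continuous_map test_topology (L2w_topology \<omega>) A"
    and zero: "A (\<lambda>x. 0) = (\<lambda>x. 0)"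
    and \<omega>: "\<omega> \<in> borel_measurable borel" "\<And>x. \<omega> x \<ge> 0"
    and K: "compact K"
  shows "\<exists>N. \<exists>\<delta>>0. \<forall>f\<in>test_fun_on K. (\<forall>j\<le>N. \<forall>x. cmod (iter_deriv j f x) < \<delta>) \<longrightarrow>
      A f \<in> L2w \<omega> \<and> (\<integral>x. \<omega> x * (cmod (A f x))\<^sup>2 \<partial>lborel) < 1"
proof -
  define B where "B = {f \<in> L2w \<omega>. (\<integral>x. \<omega> x * (cmod (f x))\<^sup>2 \<partial>lborel) < 1}"
  have o: "openin test_topology {f \<in> topspace test_topology. A f \<in> B}"
    unfolding B_def by (rule openin_continuous_map_preimage[OF cont openin_L2w_ball[OF \<omega>]])
  have "(\<lambda>x. 0) \<in> topspace test_topology"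
    using openin_subset[OF openin_test_fun] zero_test_fun by auto
  moreover have "A (\<lambda>x. 0) \<in> B"
    by (simp add: B_def L2w_def zero)
  ultimately have "(\<lambda>x. 0) \<in> {f \<in> topspace test_topology. A f \<in> B}"
    by simp
  from bspec[OF conjunct2[OF iffD1[OF openin_test_topology o]] this]
  obtain W where W: "W \<in> test_nhds0" "\<And>w. w \<in> W \<Longrightarrow> A w \<in> B"
    by auto
  from W(1) K have o': "openin (test_topology_on K) (test_fun_on K \<inter> W)"
    by (simp add: test_nhds0_def)
  have "(\<lambda>x. 0) \<in> test_fun_on K \<inter> W"
    using W(1) zero_test_fun_on by (simp add: test_nhds0_def)
  from bspec[OF conjunct2[OF iffD1[OF openin_test_topology_on o']] this]
  have "\<exists>N. \<exists>\<delta>>0. \<forall>g\<in>test_fun_on K. (\<forall>j\<le>N. \<forall>x. cmod (iter_deriv j g x) < \<delta>) \<longrightarrow> g \<in> W"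
    by simp
  then obtain N \<delta> where "\<delta> > 0"
    "\<And>g. g \<in> test_fun_on K \<Longrightarrow> (\<forall>j\<le>N. \<forall>x. cmod (iter_deriv j g x) < \<delta>) \<Longrightarrow> g \<in> W"
    by blast
  with W(2) show ?thesis
    unfolding B_def by blast
qed

section \<open>Polynomial lower bounds on the weight and the moments they control\<close>

lemma integrable_inverse_square: "integrable lborel (\<lambda>x::real. inverse (1 + x\<^sup>2))"
  using integrable_inverse_1_plus_square by (simp add: set_integrable_def)

lemma abs_power_le_square:
  fixes x :: real
  assumes "i \<le> k"
  shows "(\<bar>x\<bar> ^ i)\<^sup>2 \<le> (1 + x\<^sup>2) ^ k"
proof -
  have "(\<bar>x\<bar> ^ i)\<^sup>2 = (x\<^sup>2) ^ i"
    by (simp add: power_even_abs mult.commute flip: power_mult)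
  also have "\<dots> \<le> (1 + x\<^sup>2) ^ i" by (intro power_mono) auto
  also have "\<dots> \<le> (1 + x\<^sup>2) ^ k" by (intro power_increasing assms) auto
  finally show ?thesis .
qed

text \<open>With \<open>q = c (1 + x^2)\<close>, the key is
  \<open>2 |x|^i |u| \<le> q (|x|^i |u|)^2 + 1/q\<close>. One factor \<open>1 + x^2\<close> of the
  weight makes \<open>1/q\<close> integrable, the other \<open>k\<close> absorb
  \<open>|x|^(2i)\<close>.\<close>

lemma L2w_moment_bound:
  assumes c: "c > 0" "\<And>x. \<omega> x \<ge> c * (1 + x\<^sup>2) ^ Suc k"
    and u: "u \<in> L2w \<omega>" "(\<integral>x. \<omega> x * (cmod (u x))\<^sup>2 \<partial>lborel) < 1" and i: "i \<le> k"
  shows "integrable lborel (\<lambda>x. \<bar>x\<bar> ^ i * cmod (u x))"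
    and "(\<integral>x. \<bar>x\<bar> ^ i * cmod (u x) \<partial>lborel) \<le> 1 + (\<integral>x. inverse (1 + x\<^sup>2) \<partial>lborel) / c"
proof -
  have [measurable]: "u \<in> borel_measurable borel"
    and intu: "integrable lborel (\<lambda>x. \<omega> x * (cmod (u x))\<^sup>2)"
    using u by (auto simp: L2w_def)
  let ?g = "\<lambda>x. \<omega> x * (cmod (u x))\<^sup>2 + inverse (1 + x\<^sup>2) / c"
  have int: "integrable lborel ?g"
    using intu integrable_inverse_square by simp
  have le: "\<bar>x\<bar> ^ i * cmod (u x) \<le> ?g x" for x
  proof -
    let ?q = "c * (1 + x\<^sup>2)" and ?P = "(1 + x\<^sup>2) ^ k"
    have q: "?q > 0" using c by (intro mult_pos_pos) (auto intro: add_pos_nonneg)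
    have "2 * (\<bar>x\<bar> ^ i * cmod (u x)) \<le> ?q * (\<bar>x\<bar> ^ i * cmod (u x))\<^sup>2 + 1 / ?q"
    proof -
      define a where "a = sqrt ?q"
      have a: "a > 0" "a\<^sup>2 = ?q" using q by (auto simp: a_def)
      have "0 \<le> (a * (\<bar>x\<bar> ^ i * cmod (u x)) - 1 / a)\<^sup>2" by simp
      also have "\<dots> = a\<^sup>2 * (\<bar>x\<bar> ^ i * cmod (u x))\<^sup>2 + 1 / a\<^sup>2 - 2 * (\<bar>x\<bar> ^ i * cmod (u x))"
        using a(1) by (simp add: power2_diff power_mult_distrib power_divide)
      finally show ?thesis unfolding a(2) by linarith
    qed
    also have "?q * (\<bar>x\<bar> ^ i * cmod (u x))\<^sup>2 \<le> ?q * (?P * (cmod (u x))\<^sup>2)"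
      unfolding power_mult_distrib using q
      by (intro mult_left_mono mult_right_mono abs_power_le_square i) auto
    also have "\<dots> = (c * (1 + x\<^sup>2) ^ Suc k) * (cmod (u x))\<^sup>2" by simp
    also have "\<dots> \<le> \<omega> x * (cmod (u x))\<^sup>2"
      by (intro mult_right_mono c) auto
    finally have "2 * (\<bar>x\<bar> ^ i * cmod (u x)) \<le> \<omega> x * (cmod (u x))\<^sup>2 + 1 / ?q" by simp
    moreover have "0 \<le> \<bar>x\<bar> ^ i * cmod (u x)" by simp
    moreover have "1 / ?q = inverse (1 + x\<^sup>2) / c"
      by (simp add: field_simps)
    ultimately show ?thesis by linarith
  qed
  show int': "integrable lborel (\<lambda>x. \<bar>x\<bar> ^ i * cmod (u x))"
  proof (rule Bochner_Integration.integrable_bound[OF int])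
    show "AE x in lborel. norm (\<bar>x\<bar> ^ i * cmod (u x)) \<le> norm (?g x)"
      using le by (auto intro: order_trans[OF _ abs_ge_self])
  qed simp
  have "(\<integral>x. \<bar>x\<bar> ^ i * cmod (u x) \<partial>lborel) \<le> (\<integral>x. ?g x \<partial>lborel)"
    by (intro integral_mono int' int le)
  also have "\<dots> = (\<integral>x. \<omega> x * (cmod (u x))\<^sup>2 \<partial>lborel) + (\<integral>x. inverse (1 + x\<^sup>2) \<partial>lborel) / c"
    using intu integrable_inverse_square by simp
  finally show "(\<integral>x. \<bar>x\<bar> ^ i * cmod (u x) \<partial>lborel) \<le> 1 + (\<integral>x. inverse (1 + x\<^sup>2) \<partial>lborel) / c"
    using u(2) by simp
qed

text \<open>A nonzero lower limit is positive here and gives growth near plus infinity;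
  \<open>\<omega> \<ge> 1\<close> covers the remaining compact interval, evenness the negative
  half-line.\<close>

lemma weight_lower_bound:
  fixes \<omega> :: "real \<Rightarrow> real"
  assumes \<omega>: "\<And>x. \<omega> x \<ge> 1" and even: "\<And>x. \<omega> (- x) = \<omega> x"
    and liminf: "Liminf at_top (\<lambda>x::real. ereal (\<omega> x / x ^ (2 * k))) \<noteq> 0"
  obtains c where "c > 0" "\<And>x. \<omega> x \<ge> c * (1 + x\<^sup>2) ^ k"
proof -
  have nn: "0 \<le> Liminf at_top (\<lambda>x::real. ereal (\<omega> x / x ^ (2 * k)))"
  proof (rule Liminf_bounded)
    have "0 \<le> \<omega> x" for x using \<omega>[of x] by simp
    then show "\<forall>\<^sub>F x in at_top. 0 \<le> ereal (\<omega> x / x ^ (2 * k))"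
      by (intro always_eventually) (simp add: power_mult)
  qed
  with liminf have "0 < Liminf at_top (\<lambda>x::real. ereal (\<omega> x / x ^ (2 * k)))" by simp
  then obtain y where y: "0 < y" "y < Liminf at_top (\<lambda>x::real. ereal (\<omega> x / x ^ (2 * k)))"
    using dense by blast
  then obtain r where r: "y = ereal r"
    by (cases y) auto
  have "\<forall>\<^sub>F x in at_top. y < ereal (\<omega> x / x ^ (2 * k))"
    using y(2) by (rule less_LiminfD)
  then obtain X where X: "\<And>x. x \<ge> X \<Longrightarrow> r < \<omega> x / x ^ (2 * k)"
    by (auto simp: eventually_at_top_linorder r)
  define Y where "Y = max 1 X"
  \<comment> \<open>The first entry serves \<open>x > Y\<close>, where \<open>Y \<ge> 1\<close>
    gives \<open>1 + x^2 \<le> 2 x^2\<close>; the second serves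
    \<open>0 \<le> x \<le> Y\<close>.\<close>
  define c where "c = min (r / 2 ^ k) (1 / (1 + Y\<^sup>2) ^ k)"
  have pos: "r > 0" using y r by simp
  have Ypos: "(1 + Y\<^sup>2) ^ k > 0" by (intro zero_less_power add_pos_nonneg) auto
  have c: "c > 0" using pos Ypos by (simp add: c_def)
  have le: "\<omega> x \<ge> c * (1 + x\<^sup>2) ^ k" if x: "x \<ge> 0" for x
  proof (cases "x \<le> Y")
    case True
    have "c * (1 + x\<^sup>2) ^ k \<le> (1 / (1 + Y\<^sup>2) ^ k) * (1 + Y\<^sup>2) ^ k"
      using x True c Ypos by (intro mult_mono power_mono add_left_mono) (auto simp: c_def)
    also have "\<dots> = 1" using Ypos by (metis nonzero_eq_divide_eq order_less_irrefl)
    finally show ?thesis using \<omega>[of x] by linarith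
  next
    case False
    then have x1: "x \<ge> 1" "x \<ge> X" by (auto simp: Y_def)
    have "c * (1 + x\<^sup>2) ^ k \<le> (r / 2 ^ k) * (2 * x\<^sup>2) ^ k"
      using x1 c pos by (intro mult_mono power_mono) (auto simp: c_def one_le_power)
    also have "\<dots> = r * x ^ (2 * k)"
      by (simp add: power_mult_distrib power_mult)
    also have "\<dots> \<le> \<omega> x"
      using X[OF x1(2)] x1 by (simp add: field_simps)
    finally show ?thesis .
  qed
  have "\<omega> x \<ge> c * (1 + x\<^sup>2) ^ k" for x
    using le[of x] le[of "- x"] even[of x] by (cases "x \<ge> 0") auto
  with c show thesis by (rule that)
qed


subsection \<open>Response to wave packets\<close>

text \<open>A single term of the exponential series bounds \<open>|y|^i\<close> by a multiple of
  \<open>exp (\<eta> |y|)\<close>.\<close>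

lemma exponential_moment_integrable_power:
  assumes "exponential_moment \<rho>" and [measurable_cong]: "sets \<rho> = sets borel"
  shows "integrable \<rho> (\<lambda>y. \<bar>y\<bar> ^ i)"
proof -
  obtain \<eta> where \<eta>: "\<eta> > 0" and int: "integrable \<rho> (\<lambda>y. exp (\<eta> * \<bar>y\<bar>))"
    using assms(1) by (auto simp: exponential_moment_def)
  have "\<bar>y\<bar> ^ i \<le> (fact i / \<eta> ^ i) * exp (\<eta> * \<bar>y\<bar>)" for y :: real
  proof -
    have "(\<Sum>n\<in>{i}. inverse (fact n) * (\<eta> * \<bar>y\<bar>) ^ n) \<le> exp (\<eta> * \<bar>y\<bar>)"
      unfolding exp_def using summable_exp[of "\<eta> * \<bar>y\<bar>"] \<eta>
      by (simp only: real_scaleR_def) (intro sum_le_suminf; simp add: divide_inverse)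
    then show ?thesis
      using \<eta> by (simp add: field_simps)
  qed
  then have "norm (\<bar>y\<bar> ^ i) \<le> norm (fact i / \<eta> ^ i * exp (\<eta> * \<bar>y\<bar>))" for y :: real
    by (metis abs_ge_self abs_idempotent order_trans power_abs real_norm_def)
  note bound = this
  show ?thesis
  proof (rule Bochner_Integration.integrable_bound)
    show "integrable \<rho> (\<lambda>y. fact i / \<eta> ^ i * exp (\<eta> * \<bar>y\<bar>))"
      using int by (rule Bochner_Integration.integrable_mult_right)
    show "AE y in \<rho>. norm (\<bar>y\<bar> ^ i) \<le> norm (fact i / \<eta> ^ i * exp (\<eta> * \<bar>y\<bar>))"
      using bound by (rule AE_I2)
  qed measurable
qed

text \<open>On the unit circle \<open>|1 - w|^2 = 2 Re (1 - w)\<close>, so the mean square of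
  \<open>1 - e^(-iby)\<close> is at most twice the Fourier defect. Young's inequality carries this
  over to the first moment; the free parameter \<open>t\<close> balances the two terms
  later.\<close>

lemma first_moment_bound:
  fixes \<rho> :: "real measure" and b t :: real
  assumes prob: "prob_space \<rho>" and sets_rho [measurable_cong]: "sets \<rho> = sets borel"
    and int: "\<And>i. integrable \<rho> (\<lambda>y. \<bar>y\<bar> ^ i)" and t: "t > 0"
  shows "cmod ((\<integral>y. complex_of_real (- y) * exp (- \<i> * of_real (b * y)) \<partial>\<rho>) + of_real (\<integral>y. y \<partial>\<rho>))
    \<le> t / 2 * (\<integral>y. y\<^sup>2 \<partial>\<rho>) + cmod (1 - laplace_hat \<rho> (\<i> * of_real b)) / t"
proof -
  interpret prob_space \<rho> by (rule prob)
  let ?e = "\<lambda>y. exp (- \<i> * complex_of_real (b * y))"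
  have int1: "integrable \<rho> (\<lambda>y. y)"
    by (rule Bochner_Integration.integrable_bound[OF int[of 1]]) auto
  have int2: "integrable \<rho> (\<lambda>y. y\<^sup>2)"
    using int[of 2] by simp
  have inte: "integrable \<rho> ?e"
    by (rule integrable_const_bound[of _ 1]) auto
  have intye: "integrable \<rho> (\<lambda>y. complex_of_real (- y) * ?e y)"
    by (rule Bochner_Integration.integrable_bound[OF int1]) (auto simp: norm_mult)
  have sq: "(cmod (1 - ?e y))\<^sup>2 = 2 * Re (1 - ?e y)" for y
  proof -
    have "(cmod (1 - ?e y))\<^sup>2 = (1 - cos (b * y))\<^sup>2 + (sin (b * y))\<^sup>2"
      by (simp add: cmod_power2 Re_exp Im_exp)
    also have "\<dots> = 2 * (1 - cos (b * y))"
      using sin_cos_squared_add[of "b * y"] by (simp add: power2_eq_square algebra_simps)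
    finally show ?thesis by (simp add: Re_exp)
  qed
  have "(\<integral>y. complex_of_real (- y) * ?e y \<partial>\<rho>) + of_real (\<integral>y. y \<partial>\<rho>)
      = (\<integral>y. complex_of_real (- y) * ?e y + of_real y \<partial>\<rho>)"
    using int1 intye by simp
  also have "cmod \<dots> \<le> (\<integral>y. cmod (complex_of_real (- y) * ?e y + of_real y) \<partial>\<rho>)"
    by (rule integral_norm_bound)
  also have "\<dots> \<le> (\<integral>y. t / 2 * y\<^sup>2 + Re (1 - ?e y) / t \<partial>\<rho>)"
  proof (rule integral_mono)
    show "integrable \<rho> (\<lambda>y. cmod (complex_of_real (- y) * ?e y + of_real y))"
      using int1 intye by (intro integrable_norm Bochner_Integration.integrable_add) auto
    show "integrable \<rho> (\<lambda>y. t / 2 * y\<^sup>2 + Re (1 - ?e y) / t)"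
      using int2 inte by (intro Bochner_Integration.integrable_add) auto
    fix y
    have "complex_of_real (- y) * ?e y + of_real y = of_real y * (1 - ?e y)"
      by (simp add: algebra_simps)
    then have "cmod (complex_of_real (- y) * ?e y + of_real y) = \<bar>y\<bar> * cmod (1 - ?e y)"
      by (simp only: norm_mult norm_of_real)
    moreover have "2 * (\<bar>y\<bar> * cmod (1 - ?e y)) \<le> t * y\<^sup>2 + (cmod (1 - ?e y))\<^sup>2 / t"
    proof -
      have "0 \<le> (sqrt t * \<bar>y\<bar> - cmod (1 - ?e y) / sqrt t)\<^sup>2" by simp
      also have "\<dots> = t * y\<^sup>2 + (cmod (1 - ?e y))\<^sup>2 / t - 2 * (\<bar>y\<bar> * cmod (1 - ?e y))"
        using t by (simp add: power2_diff power_mult_distrib power_divide)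
      finally show ?thesis by simp
    qed
    moreover have "(cmod (1 - ?e y))\<^sup>2 / t = 2 * (Re (1 - ?e y) / t)"
      unfolding sq by (simp only: times_divide_eq_right)
    moreover have "t / 2 * y\<^sup>2 = (t * y\<^sup>2) / 2" by simp
    ultimately show "cmod (complex_of_real (- y) * ?e y + of_real y) \<le> t / 2 * y\<^sup>2 + Re (1 - ?e y) / t"
      by linarith
  qed
  also have "\<dots> = t / 2 * (\<integral>y. y\<^sup>2 \<partial>\<rho>) + (\<integral>y. Re (1 - ?e y) \<partial>\<rho>) / t"
    using int2 inte by (subst Bochner_Integration.integral_add) auto
  also have "(\<integral>y. Re (1 - ?e y) \<partial>\<rho>) = Re (\<integral>y. 1 - ?e y \<partial>\<rho>)"
    using inte by (intro integral_Re) auto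
  also have "(\<integral>y. 1 - ?e y \<partial>\<rho>) = 1 - laplace_hat \<rho> (\<i> * of_real b)"
    using inte by (subst Bochner_Integration.integral_diff) (auto simp: laplace_hat_def prob_space algebra_simps)
  also have "Re (1 - laplace_hat \<rho> (\<i> * of_real b)) \<le> cmod (1 - laplace_hat \<rho> (\<i> * of_real b))"
    by (rule complex_Re_le_cmod)
  finally show ?thesis
    using t by (simp add: divide_right_mono)
qed

lemma not_l_weakly_diophantineD:
  assumes "\<not> l_weakly_diophantine l \<rho>" and "\<delta> > 0"
  obtains b where "\<bar>b\<bar> \<ge> R" "\<bar>b\<bar> powr l * cmod (1 - laplace_hat \<rho> (\<i> * of_real b)) < \<delta>"
proof (rule ccontr)
  let ?h = "\<lambda>b::real. \<bar>b\<bar> powr l * cmod (1 - laplace_hat \<rho> (\<i> * of_real b))"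
  assume "\<not> thesis"
  then have "\<forall>b. \<bar>b\<bar> \<ge> R \<longrightarrow> \<delta> \<le> ?h b"
    using that by (meson not_le)
  then have "\<forall>\<^sub>F b in at_infinity. ereal \<delta> \<le> ereal (?h b)"
    unfolding eventually_at_infinity by auto
  then have "ereal \<delta> \<le> Liminf at_infinity (\<lambda>b. ereal (?h b))"
    by (rule Liminf_bounded)
  with \<open>\<delta> > 0\<close> have "0 < Liminf at_infinity (\<lambda>b. ereal (?h b))"
    by (meson ereal_less(2) less_le_trans)
  with assms(1) show False
    by (simp add: l_weakly_diophantine_def)
qed

section \<open>Modulated bump functions\<close>

text \<open>By the Leibniz formula this is the \<open>n\<close>-th derivative of
  \<open>a * exp (-ibx) * D 0 x\<close> when \<open>D\<close> is a tower of derivatives.\<close>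

definition packet :: "complex \<Rightarrow> real \<Rightarrow> (nat \<Rightarrow> real \<Rightarrow> complex) \<Rightarrow> nat \<Rightarrow> real \<Rightarrow> complex" where
  "packet a b D n x = a * (\<Sum>k\<le>n. of_nat (n choose k) *
     ((- \<i> * of_real b) ^ k * exp (- \<i> * of_real b * of_real x)) * D (n - k) x)"

lemma deriv_seq_packet:
  assumes "deriv_seq D"
  shows "deriv_seq (packet a b D)"
  using deriv_seq_lincomb[OF deriv_seq_mult[OF deriv_seq_exp assms, of "- \<i> * of_real b"] zero_deriv_seq, of a 0]
  unfolding packet_def[abs_def] by simp

lemma packet_supp:
  assumes "\<And>n x. x \<notin> K \<Longrightarrow> D n x = 0" "x \<notin> K"
  shows "packet a b D n x = 0"
  using assms by (simp add: packet_def)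

text \<open>Each differentiation costs at most one power of the frequency:
  \<open>|b| \<ge> 1\<close> lets all terms share the highest power, and the binomial coefficients
  sum to \<open>2^n\<close>.\<close>

lemma packet_bound:
  assumes "\<And>j x. j \<le> n \<Longrightarrow> cmod (D j x) \<le> M" and b: "\<bar>b\<bar> \<ge> 1"
  shows "cmod (packet a b D n x) \<le> cmod a * (2 ^ n * \<bar>b\<bar> ^ n * M)"
proof -
  have "cmod (packet a b D n x) \<le> cmod a * (\<Sum>k\<le>n. real (n choose k) * \<bar>b\<bar> ^ k * cmod (D (n - k) x))"
    unfolding packet_def norm_mult
    by (intro mult_left_mono order_trans[OF norm_sum] sum_mono)
      (auto simp: norm_mult norm_power)
  also have "\<dots> \<le> cmod a * (\<Sum>k\<le>n. real (n choose k) * \<bar>b\<bar> ^ n * M)"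
    using b assms(1) by (intro mult_left_mono sum_mono mult_mono power_increasing) auto
  also have "(\<Sum>k\<le>n. real (n choose k) * \<bar>b\<bar> ^ n * M) = 2 ^ n * \<bar>b\<bar> ^ n * M"
    by (simp add: choose_row_sum flip: sum_distrib_right of_nat_sum)
  finally show ?thesis .
qed

text \<open>Removing the modulation exposes the term \<open>- \<i> b D 0\<close>, dominant for large
  \<open>|b|\<close>, which an amplitude \<open>\<i> / b\<close> normalises to
  \<open>D 0\<close>.\<close>

lemma packet_Suc_0:
  "exp (\<i> * of_real (b * x)) * packet a b D (Suc 0) x = a * (D (Suc 0) x - \<i> * of_real b * D 0 x)"
proof -
  have "exp (\<i> * of_real (b * x)) * exp (- \<i> * of_real b * complex_of_real x) = 1"
    by (simp flip: exp_add)
  moreover have "exp (\<i> * of_real (b * x)) * packet a b D (Suc 0) x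
      = (exp (\<i> * of_real (b * x)) * exp (- \<i> * of_real b * complex_of_real x)) * (a * (D (Suc 0) x - \<i> * of_real b * D 0 x))"
    by (simp add: packet_def algebra_simps)
  ultimately show ?thesis by simp
qed

lemma deriv_seq_integrable:
  assumes D: "deriv_seq D" and supp: "\<And>n x. x \<notin> {-1..1} \<Longrightarrow> D n x = 0"
  shows "integrable lborel (\<lambda>x. complex_of_real x ^ i * D n x)"
proof -
  have "set_integrable lborel {-1..1} (\<lambda>x. complex_of_real x ^ i * D n x)"
    unfolding set_integrable_def
    by (intro borel_integrable_compact continuous_intros deriv_seq_continuous[OF D]) auto
  moreover have "indicator {-1..1} x *\<^sub>R (complex_of_real x ^ i * D n x) = complex_of_real x ^ i * D n x" for x
    using supp[of x n] by (auto simp: indicator_def)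
  ultimately show ?thesis
    by (simp only: set_integrable_def)
qed

lemma deriv_seq_bounded:
  assumes D: "deriv_seq D" and supp: "\<And>n x. x \<notin> {-1..1} \<Longrightarrow> D n x = 0"
  shows "\<exists>M. \<forall>x. cmod (D n x) \<le> M"
proof -
  have "compact (D n ` {-1..1})"
    by (intro compact_continuous_image deriv_seq_continuous[OF D]) auto
  then obtain M where "M > 0" "\<forall>z\<in>D n ` {-1..1}. cmod z \<le> M"
    using compact_imp_bounded bounded_pos by metis
  then show ?thesis
    using supp[of _ n] by (intro exI[of _ M]) (metis imageI less_imp_le norm_zero)
qed

text \<open>By \<open>conv_fun_T_measure\<close> the response differs from an element of the
  weighted space by a bounded function supported in \<open>[-1, 1]\<close>, so the weight controls
  all its moments. The last bound does not involve \<open>b\<close>, because the modulation has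
  modulus one.\<close>

lemma green_response_moments:
  fixes \<rho> :: "real measure" and \<omega> :: "real \<Rightarrow> real" and lam :: real and D :: "nat \<Rightarrow> real \<Rightarrow> complex"
  defines "A \<equiv> \<lambda>f x. conv_fun (green_measure \<rho>) f x - conv_fun (T_measure lam) f x"
    and "v \<equiv> conv_fun (green_measure \<rho>) (D (Suc 0))"
  assumes D: "deriv_seq D" and supp: "\<And>n x. x \<notin> {-1..1} \<Longrightarrow> D n x = 0" and lam: "lam > 0"
    and A: "A (D (Suc 0)) \<in> L2w \<omega>" "(\<integral>x. \<omega> x * (cmod (A (D (Suc 0)) x))\<^sup>2 \<partial>lborel) < 1"
    and weight: "\<And>m. \<exists>c>0. \<forall>x. \<omega> x \<ge> c * (1 + x\<^sup>2) ^ m"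
  shows "v \<in> borel_measurable borel"
    and "integrable lborel (\<lambda>x. complex_of_real x ^ i * v x)"
    and "\<lbrakk>c > 0; \<And>x. \<omega> x \<ge> c * (1 + x\<^sup>2) ^ Suc k; \<And>x. cmod (D 0 x) \<le> B\<rbrakk> \<Longrightarrow>
      cmod (\<integral>x. complex_of_real x ^ k * exp (\<i> * of_real (b * x)) * v x \<partial>lborel)
        \<le> 1 + (\<integral>x. inverse (1 + x\<^sup>2) \<partial>lborel) / c + 2 * B / lam"
proof -
  define u where "u = A (D (Suc 0))"
  have v_eq: "v x = u x - D 0 x / of_real lam" for x
    using conv_fun_T_measure[OF D supp lam, of x] by (simp add: u_def v_def A_def)
  have meas_u [measurable]: "u \<in> borel_measurable borel"
    using A by (simp add: u_def L2w_def)
  have [measurable]: "D 0 \<in> borel_measurable borel"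
    using deriv_seq_continuous[OF D] by (rule borel_measurable_continuous_onI)
  show meas_v [measurable]: "v \<in> borel_measurable borel"
    unfolding v_eq[abs_def] by measurable
  have u_int: "integrable lborel (\<lambda>x. complex_of_real x ^ i * u x)" for i
  proof -
    obtain c where "c > 0" "\<And>x. \<omega> x \<ge> c * (1 + x\<^sup>2) ^ Suc i"
      using weight[of "Suc i"] by blast
    from L2w_moment_bound(1)[OF this A[folded u_def] order_refl]
    show ?thesis
      by (rule Bochner_Integration.integrable_bound) (auto simp: norm_mult norm_power)
  qed
  have D_int: "integrable lborel (\<lambda>x. complex_of_real x ^ i * D 0 x)" for i
    by (rule deriv_seq_integrable[OF D supp])
  show "integrable lborel (\<lambda>x. complex_of_real x ^ i * v x)" for i
  proof -
    have "complex_of_real x ^ i * v x = complex_of_real x ^ i * u x - complex_of_real x ^ i * D 0 x / of_real lam" for x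
      by (simp add: v_eq algebra_simps)
    then show ?thesis
      using u_int D_int by simp
  qed
  note v_int = this
  assume c: "c > 0" "\<And>x. \<omega> x \<ge> c * (1 + x\<^sup>2) ^ Suc k" and B: "\<And>x. cmod (D 0 x) \<le> B"
  have B0: "B \<ge> 0" using B[of 0] norm_ge_zero order_trans by blast
  have "cmod (\<integral>x. complex_of_real x ^ k * exp (\<i> * of_real (b * x)) * v x \<partial>lborel)
      \<le> (\<integral>x. cmod (complex_of_real x ^ k * exp (\<i> * of_real (b * x)) * v x) \<partial>lborel)"
    by (rule integral_norm_bound)
  also have "\<dots> \<le> (\<integral>x. \<bar>x\<bar> ^ k * cmod (u x) + B / lam * indicator {-1..1} x \<partial>lborel)"
  proof (rule integral_mono)
    show "integrable lborel (\<lambda>x. cmod (complex_of_real x ^ k * exp (\<i> * of_real (b * x)) * v x))"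
      by (rule Bochner_Integration.integrable_bound[OF v_int[of k]]) (auto simp: norm_mult)
    show "integrable lborel (\<lambda>x. \<bar>x\<bar> ^ k * cmod (u x) + B / lam * indicator {-1..1} x)"
      using L2w_moment_bound(1)[OF c A[folded u_def] order_refl]
      by (intro Bochner_Integration.integrable_add) auto
    fix x
    have "\<bar>x\<bar> ^ k * (cmod (D 0 x) / lam) \<le> B / lam * indicator {-1..1} x"
    proof (cases "x \<in> {-1..1}")
      case True
      then have "\<bar>x\<bar> ^ k * (cmod (D 0 x) / lam) \<le> 1 * (B / lam)"
        using B lam by (intro mult_mono power_le_one divide_right_mono) auto
      then show ?thesis using True by simp
    qed (simp add: supp)
    moreover have "cmod (v x) \<le> cmod (u x) + cmod (D 0 x) / lam"
      unfolding v_eq using norm_triangle_ineq4[of "u x" "D 0 x / of_real lam"] lam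
      by (simp add: norm_divide)
    then have "\<bar>x\<bar> ^ k * cmod (v x) \<le> \<bar>x\<bar> ^ k * (cmod (u x) + cmod (D 0 x) / lam)"
      by (rule mult_left_mono) simp
    moreover have "cmod (complex_of_real x ^ k * exp (\<i> * of_real (b * x)) * v x) = \<bar>x\<bar> ^ k * cmod (v x)"
      by (simp add: norm_mult norm_power)
    ultimately show "cmod (complex_of_real x ^ k * exp (\<i> * of_real (b * x)) * v x)
        \<le> \<bar>x\<bar> ^ k * cmod (u x) + B / lam * indicator {-1..1} x"
      by (simp only: distrib_left)
  qed
  also have "\<dots> = (\<integral>x. \<bar>x\<bar> ^ k * cmod (u x) \<partial>lborel) + B / lam * 2"
    using L2w_moment_bound(1)[OF c A[folded u_def] order_refl]
    by (subst Bochner_Integration.integral_add) auto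
  also have "\<dots> \<le> 1 + (\<integral>x. inverse (1 + x\<^sup>2) \<partial>lborel) / c + 2 * B / lam"
    using L2w_moment_bound(2)[OF c A[folded u_def] order_refl] by (simp add: mult.commute)
  finally show "cmod (\<integral>x. complex_of_real x ^ k * exp (\<i> * of_real (b * x)) * v x \<partial>lborel)
        \<le> 1 + (\<integral>x. inverse (1 + x\<^sup>2) \<partial>lborel) / c + 2 * B / lam" .
qed


section \<open>The contradiction along nearly resonant frequencies\<close>

text \<open>The assumption \<open>weight\<close> is the form in which the negated conclusion enters,
  through \<open>weight_lower_bound\<close>. One normalised moment is shown to converge both to a
  nonzero number and to zero.\<close>

lemma super_polynomial_weight_impossible:
  fixes \<rho> :: "real measure" and lam :: real and \<omega> :: "real \<Rightarrow> real"
  defines "A \<equiv> \<lambda>f x. conv_fun (green_measure \<rho>) f x - conv_fun (T_measure lam) f x"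
  assumes prob: "prob_space \<rho>" and sets_rho: "sets \<rho> = sets borel"
    and expm: "exponential_moment \<rho>"
    and lam: "lam = (\<integral>y. y \<partial>\<rho>)" "lam > 0"
    and l: "l > 0" "\<not> l_weakly_diophantine l \<rho>"
    and \<omega>: "\<omega> \<in> borel_measurable borel" "\<And>x. \<omega> x \<ge> 0"
    and weight: "\<And>m. \<exists>c>0. \<forall>x. \<omega> x \<ge> c * (1 + x\<^sup>2) ^ m"
    and int: "\<And>f x. f \<in> test_fun \<Longrightarrow> integrable (green_measure \<rho>) (\<lambda>y. f (x - y))"
    and cont: "continuous_map test_topology (L2w_topology \<omega>) A"
  shows False
proof -
  have A0: "A (\<lambda>x. 0) = (\<lambda>x. 0)"
    by (simp add: A_def conv_fun_def)
  obtain N \<delta> where \<delta>: "\<delta> > 0" and N: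
    "\<And>f. f \<in> test_fun_on {-1..1} \<Longrightarrow> (\<And>j x. j \<le> N \<Longrightarrow> cmod (iter_deriv j f x) < \<delta>) \<Longrightarrow>
      A f \<in> L2w \<omega> \<and> (\<integral>x. \<omega> x * (cmod (A f x))\<^sup>2 \<partial>lborel) < 1"
    using continuous_map_L2w_bound[OF cont A0 \<omega> compact_Icc[of "-1" 1]] by blast
  \<comment> \<open>The order is fixed before the frequencies: \<open>l (k + 1) \<ge> N\<close> lets
    the smallness of \<open>|b|^l |\<epsilon>|\<close>, raised to the power \<open>k + 1\<close>,
    beat the loss \<open>|b|^N\<close>.\<close>
  obtain k where k: "l * real (Suc k) \<ge> real N"
  proof -
    obtain k where "real N / l < real k"
      using reals_Archimedean2 by blast
    then have "real N \<le> l * real (Suc k)"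
      using l by (simp add: field_simps)
    then show thesis by (rule that)
  qed
  obtain c where c: "c > 0" "\<And>x. \<omega> x \<ge> c * (1 + x\<^sup>2) ^ Suc k"
    using weight[of "Suc k"] by blast
  obtain D where D: "deriv_seq D" and supp: "\<And>n x. x \<notin> {-1..1} \<Longrightarrow> D n x = 0"
    and D0: "(\<integral>x. D 0 x \<partial>lborel) \<noteq> 0"
    using bump_exists by metis
  obtain M where M: "M > 0" "\<And>j x. j \<le> Suc N \<Longrightarrow> cmod (D j x) \<le> M"
  proof -
    obtain M' where M': "\<And>j x. cmod (D j x) \<le> M' j"
      using deriv_seq_bounded[OF D supp] by metis
    have "0 \<le> M' j" for j
      using M'[of j 0] norm_ge_zero order_trans by blast
    then have "0 < 1 + (\<Sum>j\<le>Suc N. M' j)"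
      by (intro add_pos_nonneg sum_nonneg) auto
    moreover have "cmod (D j x) \<le> 1 + (\<Sum>j\<le>Suc N. M' j)" if "j \<le> Suc N" for j x
    proof -
      have "M' j \<le> (\<Sum>j\<le>Suc N. M' j)"
        using that \<open>\<And>j. 0 \<le> M' j\<close> by (intro member_le_sum) auto
      then show ?thesis using M'[of j x] by linarith
    qed
    ultimately show thesis by (rule that)
  qed
  \<comment> \<open>With the factor \<open>\<i> / b\<close> in \<open>E\<close> below, \<open>e^(ibx) E 1\<close> has the non-vanishing limit profile \<open>D 0\<close>;
    \<open>s / |b|^N\<close> makes \<open>E 1\<close> small enough for the continuity estimate.\<close>
  define s where "s = \<delta> / (2 ^ Suc (Suc N) * M)"
  have s: "s > 0" "s * (2 ^ Suc N * M) < \<delta>"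
    using \<delta> M by (auto simp: s_def)
  have "\<exists>b. \<bar>b\<bar> \<ge> real (Suc n) \<and> \<bar>b\<bar> powr l * cmod (1 - laplace_hat \<rho> (\<i> * of_real b)) < 1 / real (Suc n)" for n
    by (rule not_l_weakly_diophantineD[OF l(2), of "1 / real (Suc n)" "real (Suc n)"]) auto
  then obtain b where b: "\<And>n. \<bar>b n\<bar> \<ge> real (Suc n)"
    and b\<epsilon>: "\<And>n. \<bar>b n\<bar> powr l * cmod (1 - laplace_hat \<rho> (\<i> * of_real (b n))) < 1 / real (Suc n)"
    by metis
  define \<epsilon> where "\<epsilon> = (\<lambda>n. 1 - laplace_hat \<rho> (\<i> * of_real (b n)))"
  have b1: "\<bar>b n\<bar> \<ge> 1" for n using b[of n] by simp
  define E where "E = (\<lambda>n. packet (of_real (s / \<bar>b n\<bar> ^ N) * (\<i> / of_real (b n))) (b n) D)"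
  have E: "deriv_seq (E n)" for n
    unfolding E_def by (rule deriv_seq_packet[OF D])
  have E_supp: "E n j x = 0" if "x \<notin> {-1..1}" for n j x
    unfolding E_def using supp that by (rule packet_supp)
  \<comment> \<open>The range reaches \<open>Suc N\<close> because \<open>f n\<close> below is
    already a first derivative. The amplitude contributes \<open>|b|^(-(N + 1))\<close>, one power
    of it from \<open>\<i> / b\<close>, and this pays for all these derivatives.\<close>
  have E_bound: "cmod (E n j x) \<le> s * (2 ^ j * M)" if "j \<le> Suc N" for n j x
  proof -
    have "cmod (E n j x) \<le> cmod (of_real (s / \<bar>b n\<bar> ^ N) * (\<i> / of_real (b n))) * (2 ^ j * \<bar>b n\<bar> ^ j * M)"
      unfolding E_def using M that b1 by (intro packet_bound) auto
    also have "\<dots> = s * (2 ^ j * M) * (\<bar>b n\<bar> ^ j / \<bar>b n\<bar> ^ Suc N)"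
      using s by (simp add: norm_mult norm_divide norm_power mult_ac)
    also have "\<dots> \<le> s * (2 ^ j * M) * 1"
      using s M b1[of n] that
      by (intro mult_left_mono) (auto simp: divide_le_eq_1 intro!: power_increasing simp del: power_Suc)
    finally show ?thesis by simp
  qed
  define f where "f = (\<lambda>n. E n (Suc 0))"
  have f_test: "f n \<in> test_fun_on {-1..1}" for n
    using smooth_deriv_seq[OF deriv_seq_Suc[OF E]] E_supp by (auto simp: test_fun_on_def f_def)
  have f_test': "f n \<in> test_fun" for n
    using f_test unfolding test_fun_def by blast
  have f_meas: "f n \<in> borel_measurable borel" for n
    unfolding f_def using deriv_seq_continuous[OF E] by (rule borel_measurable_continuous_onI)
  have Af: "A (f n) \<in> L2w \<omega>" "(\<integral>x. \<omega> x * (cmod (A (f n) x))\<^sup>2 \<partial>lborel) < 1" for n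
  proof -
    have "cmod (iter_deriv j (f n) x) < \<delta>" if "j \<le> N" for j x
    proof -
      have "iter_deriv j (f n) = E n (Suc j)"
        using iter_deriv_deriv_seq[OF deriv_seq_Suc[OF E]] by (simp add: f_def)
      then have "cmod (iter_deriv j (f n) x) \<le> s * (2 ^ Suc j * M)"
        using E_bound[of "Suc j" n x] that by simp
      also have "\<dots> \<le> s * (2 ^ Suc N * M)"
        using s M that by (intro mult_left_mono mult_right_mono power_increasing) auto
      finally show ?thesis using s by linarith
    qed
    then show "A (f n) \<in> L2w \<omega>" "(\<integral>x. \<omega> x * (cmod (A (f n) x))\<^sup>2 \<partial>lborel) < 1"
      using N[OF f_test] by auto
  qed
  define v where "v = (\<lambda>n. conv_fun (green_measure \<rho>) (f n))"
  have v_eq: "v n = conv_fun (green_measure \<rho>) (E n (Suc 0))" for n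
    by (simp add: v_def f_def)
  have A_eq: "conv_fun (green_measure \<rho>) (E n (Suc 0)) x - conv_fun (T_measure lam) (E n (Suc 0)) x = A (f n) x" for n x
    by (simp add: A_def f_def)
  have v_meas: "v n \<in> borel_measurable borel" for n
    unfolding v_eq
    by (rule green_response_moments(1)[where D = "E n" and lam = lam and \<omega> = \<omega>])
      (use E E_supp lam(2) Af weight in \<open>auto simp: A_eq\<close>)
  have v_int: "integrable lborel (\<lambda>x. complex_of_real x ^ i * v n x)" for i n
    unfolding v_eq
    by (rule green_response_moments(2)[where D = "E n" and lam = lam and \<omega> = \<omega>])
      (use E E_supp lam(2) Af weight in \<open>auto simp: A_eq\<close>)
  have int\<rho>: "integrable \<rho> (\<lambda>y. \<bar>y\<bar> ^ i)" for i
    by (rule exponential_moment_integrable_power[OF expm sets_rho])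
  define m where "m = (\<lambda>i n. \<integral>y. complex_of_real (- y) ^ i * exp (- \<i> * of_real (b n * y)) \<partial>\<rho>)"
  define V where "V = (\<lambda>i n. \<integral>x. complex_of_real x ^ i * exp (\<i> * of_real (b n * x)) * v n x \<partial>lborel)"
  define F where "F = (\<lambda>i n. \<integral>x. complex_of_real x ^ i * exp (\<i> * of_real (b n * x)) * f n x \<partial>lborel)"
  define P where "P = (\<lambda>q i. \<integral>x. complex_of_real x ^ i * D q x \<partial>lborel)"
  have V_rec: "V j n = F j n + (\<Sum>i\<le>j. of_nat (j choose i) * m i n * V (j - i) n)" for j n
    unfolding V_def F_def m_def v_def
    using int f_test' v_meas[unfolded v_def] v_int[unfolded v_def]
    by (intro moment_renewal prob sets_rho int\<rho>
        conv_fun_green_renewal(2)[OF prob sets_rho f_meas]) auto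
  have m0: "m 0 n = 1 - \<epsilon> n" for n
    by (simp add: m_def \<epsilon>_def laplace_hat_def mult.assoc)
  \<comment> \<open>The term \<open>i = 0\<close> contains \<open>V j\<close> itself with
    coefficient \<open>1 - \<epsilon> n\<close>; moving it to the left leaves only the small factor
    \<open>\<epsilon> n\<close>.\<close>
  have \<epsilon>V: "\<epsilon> n * V j n = F j n + (\<Sum>i=1..j. of_nat (j choose i) * m i n * V (j - i) n)" for j n
  proof -
    have "{..j} = insert 0 {1..j}" by auto
    then have "(\<Sum>i\<le>j. of_nat (j choose i) * m i n * V (j - i) n)
        = m 0 n * V j n + (\<Sum>i=1..j. of_nat (j choose i) * m i n * V (j - i) n)"
      by simp
    then have "V j n = F j n + ((1 - \<epsilon> n) * V j n + (\<Sum>i=1..j. of_nat (j choose i) * m i n * V (j - i) n))"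
      using V_rec[of j n] by (simp only: m0)
    moreover have "e * x = y + s" if "x = y + ((1 - e) * x + s)" for e x y s :: complex
      using that by algebra
    ultimately show ?thesis by blast
  qed
  have F_eq: "F j n = of_real (s / \<bar>b n\<bar> ^ N) * (P 0 j + \<i> / of_real (b n) * P 1 j)" for j n
  proof -
    have bn: "b n \<noteq> 0" using b1[of n] by auto
    have "exp (\<i> * of_real (b n * x)) * f n x
        = of_real (s / \<bar>b n\<bar> ^ N) * (D 0 x + \<i> / of_real (b n) * D 1 x)" for x
      unfolding f_def E_def packet_Suc_0 using bn by (simp add: field_simps)
    then have "complex_of_real x ^ j * exp (\<i> * of_real (b n * x)) * f n x
        = of_real (s / \<bar>b n\<bar> ^ N) * (complex_of_real x ^ j * D 0 x + \<i> / of_real (b n) * (complex_of_real x ^ j * D 1 x))" for x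
      by (simp only: mult.assoc) (simp only: distrib_left mult_ac)
    then have "F j n = (\<integral>x. of_real (s / \<bar>b n\<bar> ^ N) * (complex_of_real x ^ j * D 0 x
        + \<i> / of_real (b n) * (complex_of_real x ^ j * D 1 x)) \<partial>lborel)"
      by (simp only: F_def)
    also have "\<dots> = of_real (s / \<bar>b n\<bar> ^ N) * (P 0 j + \<i> / of_real (b n) * P 1 j)"
      unfolding P_def integral_mult_right_zero
      by (subst Bochner_Integration.integral_add)
        (auto intro!: deriv_seq_integrable[OF D supp] Bochner_Integration.integrable_mult_right)
    finally show ?thesis .
  qed
  \<comment> \<open>The expected size of \<open>V j\<close> is
    \<open>|b|^(-N) |\<epsilon>|^(-(j + 1))\<close>, and \<open>U\<close> removes this scale. The
    powers of \<open>\<epsilon>\<close> are distributed so that \<open>a 1\<close> keeps none and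
    \<open>a i\<close> with \<open>i \<ge> 2\<close> keeps at least one.\<close>
  define U where "U = (\<lambda>j n. of_real (\<bar>b n\<bar> ^ N) * \<epsilon> n ^ Suc j * V j n)"
  define e where "e = (\<lambda>j n. of_real (\<bar>b n\<bar> ^ N) * \<epsilon> n ^ j * F j n)"
  define a where "a = (\<lambda>i n. \<epsilon> n ^ (i - 1) * m i n)"
  have rec: "U j n = e j n + (\<Sum>i=1..j. of_nat (j choose i) * a i n * U (j - i) n)" for j n
  proof -
    have "U j n = of_real (\<bar>b n\<bar> ^ N) * \<epsilon> n ^ j * (\<epsilon> n * V j n)"
      by (simp add: U_def algebra_simps)
    also have "\<dots> = e j n + (\<Sum>i=1..j. of_real (\<bar>b n\<bar> ^ N) * \<epsilon> n ^ j * (of_nat (j choose i) * m i n * V (j - i) n))"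
      unfolding \<epsilon>V by (simp add: e_def distrib_left sum_distrib_left)
    also have "(\<Sum>i=1..j. of_real (\<bar>b n\<bar> ^ N) * \<epsilon> n ^ j * (of_nat (j choose i) * m i n * V (j - i) n))
        = (\<Sum>i=1..j. of_nat (j choose i) * a i n * U (j - i) n)"
    proof (rule sum.cong[OF refl])
      fix i assume "i \<in> {1..j}"
      \<comment> \<open>As \<open>1 \<le> i \<le> j\<close>, the exponents \<open>i - 1\<close> and
        \<open>Suc (j - i)\<close> add up to \<open>j\<close> without truncation.\<close>
      then have "\<epsilon> n ^ j = \<epsilon> n ^ (i - 1) * \<epsilon> n ^ Suc (j - i)"
        by (simp flip: power_add del: power_Suc)
      then show "of_real (\<bar>b n\<bar> ^ N) * \<epsilon> n ^ j * (of_nat (j choose i) * m i n * V (j - i) n)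
          = of_nat (j choose i) * a i n * U (j - i) n"
        by (simp only: a_def U_def ac_simps)
    qed
    finally show ?thesis .
  qed
  have \<epsilon>_le: "cmod (\<epsilon> n) \<le> 1 / real (Suc n)" for n
  proof -
    have "1 * cmod (\<epsilon> n) \<le> \<bar>b n\<bar> powr l * cmod (\<epsilon> n)"
      using l b1[of n] by (intro mult_right_mono ge_one_powr_ge_zero) auto
    with b\<epsilon>[of n] show ?thesis by (simp add: \<epsilon>_def)
  qed
  have inv: "(\<lambda>n. 1 / real (Suc n)) \<longlonglongrightarrow> 0"
    by (rule LIMSEQ_Suc[OF lim_1_over_n])
  have \<epsilon>_lim: "\<epsilon> \<longlonglongrightarrow> 0"
    by (rule Lim_null_comparison[OF _ inv]) (use \<epsilon>_le in auto)
  have b_lim: "(\<lambda>n. \<i> / of_real (b n)) \<longlonglongrightarrow> 0"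
  proof (rule Lim_null_comparison[OF _ inv])
    have "cmod (\<i> / of_real (b n)) \<le> 1 / real (Suc n)" for n
      using b[of n] by (auto simp: norm_divide intro!: divide_left_mono mult_pos_pos)
    then show "\<forall>\<^sub>F n in sequentially. cmod (\<i> / of_real (b n)) \<le> 1 / real (Suc n)" by simp
  qed
  have e_eq: "e j n = \<epsilon> n ^ j * (of_real s * (P 0 j + \<i> / of_real (b n) * P 1 j))" for j n
  proof -
    have "complex_of_real (\<bar>b n\<bar> ^ N) * of_real (s / \<bar>b n\<bar> ^ N) = of_real s"
      using b1[of n] by (simp flip: of_real_mult of_real_power of_real_divide)
    moreover have "e j n = \<epsilon> n ^ j * ((complex_of_real (\<bar>b n\<bar> ^ N) * of_real (s / \<bar>b n\<bar> ^ N)) * (P 0 j + \<i> / of_real (b n) * P 1 j))"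
      unfolding e_def F_eq by (simp only: ac_simps)
    ultimately show ?thesis by simp
  qed
  \<comment> \<open>\<open>0 ^ j\<close> is one for \<open>j = 0\<close> and zero otherwise, so only
    \<open>e 0\<close> can have a nonzero limit.\<close>
  have e_lim: "e j \<longlonglongrightarrow> 0 ^ j * (of_real s * (P 0 j + 0 * P 1 j))" for j
    unfolding e_eq[abs_def] by (intro tendsto_intros \<epsilon>_lim b_lim)
  have m1_lim: "m 1 \<longlonglongrightarrow> - of_real lam"
  proof -
    \<comment> \<open>The square of \<open>?t n\<close> is the bound \<open>1 / (n + 1)\<close> on
      \<open>|\<epsilon> n|\<close>, so both terms of \<open>first_moment_bound\<close> are of order
      \<open>?t n\<close>.\<close>
    let ?t = "\<lambda>n. sqrt (1 / real (Suc n))"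
    have "cmod (m 1 n - - of_real lam) \<le> ?t n / 2 * (\<integral>y. y\<^sup>2 \<partial>\<rho>) + ?t n" for n
    proof -
      have t: "?t n > 0" by simp
      have "cmod (m 1 n - - of_real lam) \<le> ?t n / 2 * (\<integral>y. y\<^sup>2 \<partial>\<rho>) + cmod (\<epsilon> n) / ?t n"
        using first_moment_bound[OF prob sets_rho int\<rho> t, of "b n"]
        by (simp add: m_def \<epsilon>_def lam(1))
      also have "cmod (\<epsilon> n) / ?t n \<le> (1 / real (Suc n)) / ?t n"
        using \<epsilon>_le t by (intro divide_right_mono) auto
      also have "(1 / real (Suc n)) / ?t n = ?t n"
        by (rule real_div_sqrt) simp
      finally show ?thesis by simp
    qed
    then have le: "\<forall>\<^sub>F n in sequentially. cmod (m 1 n - - of_real lam) \<le> ?t n / 2 * (\<integral>y. y\<^sup>2 \<partial>\<rho>) + ?t n"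
      by (rule always_eventually[OF allI])
    have "(\<lambda>n. ?t n / 2 * (\<integral>y. y\<^sup>2 \<partial>\<rho>) + ?t n) \<longlonglongrightarrow> sqrt 0 / 2 * (\<integral>y. y\<^sup>2 \<partial>\<rho>) + sqrt 0"
      by (intro tendsto_intros inv) simp
    then have "(\<lambda>n. ?t n / 2 * (\<integral>y. y\<^sup>2 \<partial>\<rho>) + ?t n) \<longlonglongrightarrow> 0" by simp
    with le have "(\<lambda>n. m 1 n - - of_real lam) \<longlonglongrightarrow> 0"
      by (rule Lim_null_comparison)
    then show ?thesis by (simp only: LIM_zero_iff)
  qed
  \<comment> \<open>The moment \<open>m i n\<close> is bounded by the absolute moment of
    \<open>\<rho>\<close>, whatever the frequency, and \<open>\<epsilon> n\<close> enters with the
    positive exponent \<open>i - 1\<close>.\<close>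
  have a_lim: "a i \<longlonglongrightarrow> 0" if i: "i \<ge> 2" for i
  proof (rule Lim_null_comparison)
    let ?C = "\<integral>y. \<bar>y\<bar> ^ i \<partial>\<rho>"
    have "cmod (a i n) \<le> cmod (\<epsilon> n) ^ (i - 1) * ?C" for n
    proof -
      have "cmod (m i n) \<le> (\<integral>y. cmod (complex_of_real (- y) ^ i * exp (- \<i> * of_real (b n * y))) \<partial>\<rho>)"
        unfolding m_def by (rule integral_norm_bound)
      also have "\<dots> = ?C"
        by (simp add: norm_mult norm_power)
      finally show ?thesis
        unfolding a_def norm_mult norm_power by (rule mult_left_mono) simp
    qed
    then show "\<forall>\<^sub>F n in sequentially. cmod (a i n) \<le> cmod (\<epsilon> n) ^ (i - 1) * ?C" by simp
    have "(\<lambda>n. cmod (\<epsilon> n) ^ (i - 1) * ?C) \<longlonglongrightarrow> cmod 0 ^ (i - 1) * ?C"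
      by (intro tendsto_intros \<epsilon>_lim)
    then show "(\<lambda>n. cmod (\<epsilon> n) ^ (i - 1) * ?C) \<longlonglongrightarrow> 0"
      using i by (simp add: power_0_left)
  qed
  have "\<exists>L. L \<noteq> 0 \<and> U k \<longlonglongrightarrow> L"
  proof (rule recursion_limit_nonzero[OF rec])
    show "e 0 \<longlonglongrightarrow> of_real s * P 0 0" using e_lim[of 0] by simp
    show "of_real s * P 0 0 \<noteq> 0" using s D0 by (simp add: P_def)
    show "e j \<longlonglongrightarrow> 0" if "j \<ge> 1" for j using e_lim[of j] that by (simp add: power_0_left)
    show "a 1 \<longlonglongrightarrow> - of_real lam" using m1_lim by (simp add: a_def)
    show "- complex_of_real lam \<noteq> 0" using lam by simp
  qed (rule a_lim)
  \<comment> \<open>The choice of \<open>k\<close> gives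
    \<open>|b|^N |\<epsilon>|^(k + 1) \<le> 1 / (n + 1)\<close>, while continuity keeps
    \<open>V k\<close> bounded in \<open>n\<close>.\<close>
  moreover have "U k \<longlonglongrightarrow> 0"
  proof (rule Lim_null_comparison)
    define C where "C = 1 + (\<integral>x. inverse (1 + x\<^sup>2) \<partial>lborel) / c + 2 * (s * M) / lam"
    have V_le: "cmod (V k n) \<le> C" for n
      unfolding V_def C_def v_eq
    proof (rule green_response_moments(3)[where D = "E n" and \<omega> = \<omega>])
      show "cmod (E n 0 x) \<le> s * M" for x
        using E_bound[of 0 n x] by simp
    qed (use E E_supp lam(2) Af weight c in \<open>auto simp: A_eq simp del: power_Suc\<close>)
    have "cmod (U k n) \<le> 1 / real (Suc n) * C" for n
    proof -
      have "\<bar>b n\<bar> ^ N = \<bar>b n\<bar> powr real N"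
        using b1[of n] by (simp add: powr_realpow)
      also have "\<dots> \<le> \<bar>b n\<bar> powr (l * real (Suc k))"
        using k b1[of n] by (intro powr_mono) auto
      also have "\<dots> = (\<bar>b n\<bar> powr l) ^ Suc k"
        using b1[of n] by (subst powr_realpow[symmetric]) (auto simp: powr_powr)
      finally have "\<bar>b n\<bar> ^ N * cmod (\<epsilon> n) ^ Suc k \<le> (\<bar>b n\<bar> powr l) ^ Suc k * cmod (\<epsilon> n) ^ Suc k"
        by (rule mult_right_mono) simp
      also have "\<dots> = (\<bar>b n\<bar> powr l * cmod (\<epsilon> n)) ^ Suc k"
        by (simp only: power_mult_distrib)
      also have "\<dots> \<le> (1 / real (Suc n)) ^ Suc k"
        using b\<epsilon>[of n] by (intro power_mono) (auto simp: \<epsilon>_def)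
      also have "\<dots> \<le> (1 / real (Suc n)) ^ 1"
        by (intro power_decreasing) auto
      finally have "\<bar>b n\<bar> ^ N * cmod (\<epsilon> n) ^ Suc k \<le> 1 / real (Suc n)" by simp
      then have "(\<bar>b n\<bar> ^ N * cmod (\<epsilon> n) ^ Suc k) * cmod (V k n) \<le> 1 / real (Suc n) * C"
        using V_le by (intro mult_mono) auto
      then show ?thesis
        by (simp add: U_def norm_mult norm_power)
    qed
    then show "\<forall>\<^sub>F n in sequentially. cmod (U k n) \<le> 1 / real (Suc n) * C" by simp
    have "(\<lambda>n. 1 / real (Suc n) * C) \<longlonglongrightarrow> 0 * C"
      by (intro tendsto_intros inv)
    then show "(\<lambda>n. 1 / real (Suc n) * C) \<longlonglongrightarrow> 0" by simp
  qed
  ultimately show False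
    using LIMSEQ_unique by blast
qed

theorem proposition4p6:
  fixes \<rho> :: "real measure" and lam :: real and \<omega> :: "real \<Rightarrow> real"
  assumes "prob_space \<rho>" and "sets \<rho> = sets borel"
    and "exponential_moment \<rho>"
    and "lam = (\<integral>y. y \<partial>\<rho>)" and "lam > 0"
    and "weakly_diophantine \<rho>"
    and "\<exists>l>0. \<not> l_weakly_diophantine l \<rho>"
    and "\<omega> \<in> Omega_class"
    and "\<And>f x. f \<in> test_fun \<Longrightarrow> integrable (green_measure \<rho>) (\<lambda>y. f (x - y))
           \<and> integrable (T_measure lam) (\<lambda>y. f (x - y))"
    and "continuous_map test_topology (L2w_topology \<omega>)
           (\<lambda>f x. conv_fun (green_measure \<rho>) f x - conv_fun (T_measure lam) f x)"
  shows "\<exists>k::nat. Liminf at_top (\<lambda>x::real. ereal (\<omega> x / x ^ k)) = 0"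
proof (rule ccontr)
  assume "\<not> ?thesis"
  \<comment> \<open>Even exponents match the powers of \<open>1 + x^2\<close> in which the growth of
    the weight is expressed.\<close>
  then have liminf: "Liminf at_top (\<lambda>x::real. ereal (\<omega> x / x ^ (2 * m))) \<noteq> 0" for m
    by blast
  have \<omega>: "continuous_on UNIV \<omega>" "\<And>x. \<omega> x \<ge> 1" "\<And>x. \<omega> (- x) = \<omega> x"
    using assms(8) by (auto simp: Omega_class_def)
  have weight: "\<exists>c>0. \<forall>x. \<omega> x \<ge> c * (1 + x\<^sup>2) ^ m" for m
    using weight_lower_bound[OF \<omega>(2,3) liminf[of m]] by metis
  obtain l where "l > 0" "\<not> l_weakly_diophantine l \<rho>"
    using assms(7) by blast
  then show False
  proof (rule super_polynomial_weight_impossible[OF assms(1-5)])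
    show "\<omega> \<in> borel_measurable borel"
      using \<omega>(1) by (rule borel_measurable_continuous_onI)
    show "0 \<le> \<omega> x" for x
      using \<omega>(2)[of x] by simp
  qed (use assms(9,10) weight in auto)
qed

end
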